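(* Let $\Omega\subset\mathbb R^2$ be a bounded domain and let $L\in(0,\mathcal{SM}(\overline\Omega))$. Then there exists a maximizer $K_{\mathrm{opt}}$ of the problem $$\max\{\lambda_1(\Omega\setminus K): K\subseteq\overline\Omega,\ K \text{ continuum},\ \mathcal{SM}(K)\le L\}.$$
   Context: A continuum is a compact, connected, non-empty set. For a closed set $K\subset\mathbb R^2$ and $\epsilon>0$ let $K^{\oplus\epsilon}=\{x\in\mathbb R^2: \mathrm d_K(x)\le\epsilon\}$, where $\mathrm d_K$ is the distance function to $K$, and let $\mathcal L$ be the Lebesgue measure on $\mathbb R^2$. The outer Minkowski content of $K$ is $\mathcal{SM}(K)=\lim_{\epsilon\to0^+}\mathcal L(K^{\oplus\epsilon}\setminus K)/\epsilon\in[0,+\infty]$ whenever this limit exists; for every continuum in $\mathbb R^2$ the limit exists (possibly $+\infty$). For a bounded open set $D\subset\mathbb R^2$, $\lambda_1(D)=\min\{\int_D|\nabla u|^2/\int_D u^2: u\in H^1_0(D), u\ne0\}$ is the first Dirichlet eigenvalue of the Laplacian, with $\lambda_1(\emptyset)=+\infty$. No regularity of $\partial\Omega$ is assumed; a domain is a non-empty connected open set. *)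

theory Defs
  imports "HOL-Analysis.Analysis"
begin

definition continuum :: "(real^2) set \<Rightarrow> bool" where
  "continuum K \<longleftrightarrow> compact K \<and> connected K \<and> K \<noteq> {}"

definition closed_nbhd :: "real \<Rightarrow> (real^2) set \<Rightarrow> (real^2) set" where
  "closed_nbhd \<epsilon> K = {x. infdist x K \<le> \<epsilon>}"

(* Lim is the library's limit operator: it denotes the limit in [0,\<infinity>] whenever that limit exists
   (in particular for every continuum) and is unspecified otherwise. *)
definition outer_minkowski_content :: "(real^2) set \<Rightarrow> ennreal" where
  "outer_minkowski_content K =
     Lim (at_right 0) (\<lambda>\<epsilon>. emeasure lebesgue (closed_nbhd \<epsilon> K - K) / ennreal \<epsilon>)"

fun Ck :: "nat \<Rightarrow> (real^2 \<Rightarrow> real) \<Rightarrow> bool" where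
  "Ck 0 f \<longleftrightarrow> continuous_on UNIV f"
| "Ck (Suc k) f \<longleftrightarrow> (\<forall>x. f differentiable (at x)) \<and>
      (\<forall>v. Ck k (\<lambda>x. frechet_derivative f (at x) v))"

definition test_functions :: "(real^2) set \<Rightarrow> (real^2 \<Rightarrow> real) set" where
  "test_functions D = {\<phi>. (\<forall>k. Ck k \<phi>) \<and>
      compact (closure {x. \<phi> x \<noteq> 0}) \<and> closure {x. \<phi> x \<noteq> 0} \<subseteq> D}"

definition gradient :: "(real^2 \<Rightarrow> real) \<Rightarrow> real^2 \<Rightarrow> real^2" where
  "gradient \<phi> x = (\<chi> i. frechet_derivative \<phi> (at x) (axis i 1))"

definition L2_on :: "(real^2) set \<Rightarrow> (real^2 \<Rightarrow> 'b::euclidean_space) \<Rightarrow> bool" where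
  "L2_on D f \<longleftrightarrow> f \<in> borel_measurable (lebesgue_on D) \<and>
      integrable (lebesgue_on D) (\<lambda>x. (norm (f x))\<^sup>2)"

definition weak_gradient :: "(real^2) set \<Rightarrow> (real^2 \<Rightarrow> real) \<Rightarrow> (real^2 \<Rightarrow> real^2) \<Rightarrow> bool" where
  "weak_gradient D u g \<longleftrightarrow>
     (\<forall>\<phi>\<in>test_functions D.
        integral\<^sup>L (lebesgue_on D) (\<lambda>x. u x *\<^sub>R gradient \<phi> x) =
        - integral\<^sup>L (lebesgue_on D) (\<lambda>x. \<phi> x *\<^sub>R g x))"

(* H1_rel D u g: u (taken up to null sets) lies in H\<^sup>1(D) and g represents its weak gradient,
   which is unique almost everywhere on D when D is open. *)
definition H1_rel :: "(real^2) set \<Rightarrow> (real^2 \<Rightarrow> real) \<Rightarrow> (real^2 \<Rightarrow> real^2) \<Rightarrow> bool" where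
  "H1_rel D u g \<longleftrightarrow> L2_on D u \<and> L2_on D g \<and> weak_gradient D u g"

(* u \<in> H\<^sup>1\<^sub>0(D), the closure of the test functions in the H\<^sup>1 norm, with weak gradient g. *)
definition H10_rel :: "(real^2) set \<Rightarrow> (real^2 \<Rightarrow> real) \<Rightarrow> (real^2 \<Rightarrow> real^2) \<Rightarrow> bool" where
  "H10_rel D u g \<longleftrightarrow> H1_rel D u g \<and>
     (\<exists>\<phi>::nat \<Rightarrow> real^2 \<Rightarrow> real. (\<forall>n. \<phi> n \<in> test_functions D) \<and>
        (\<lambda>n. integral\<^sup>L (lebesgue_on D) (\<lambda>x. (\<phi> n x - u x)\<^sup>2) +
             integral\<^sup>L (lebesgue_on D) (\<lambda>x. (norm (gradient (\<phi> n) x - g x))\<^sup>2))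
        \<longlonglongrightarrow> 0)"

(* The infimum of the Rayleigh quotient is attained for every non-empty bounded open D, so it is the
   minimum there; for empty D it is an infimum over the empty set, i.e. \<infinity>. *)
definition lambda1 :: "(real^2) set \<Rightarrow> ereal" where
  "lambda1 D = Inf {ereal (integral\<^sup>L (lebesgue_on D) (\<lambda>x. (norm (g x))\<^sup>2) /
                           integral\<^sup>L (lebesgue_on D) (\<lambda>x. (u x)\<^sup>2)) | u g.
                      H10_rel D u g \<and> \<not> (AE x in lebesgue_on D. u x = 0)}"

lemma lambda1_empty: "lambda1 {} = \<infinity>"
  by (simp add: lambda1_def top_ereal_def AE_restrict_space_iff)

end

(* A maximising sequence of continua has a Hausdorff-convergent subsequence, so everything rests on two
   semicontinuity statements. The eigenvalue is upper semicontinuous because a test function supported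
   off the limit set is eventually supported off the approximating sets.

   For the content, let V(t) be the area of the closed t-neighbourhood of a continuum K. Then
     V(s + t) + V(0) <= V(s) + V(t) + 16 s t,
   so W = V - V(0) is subadditive up to a quadratic error and Fekete's argument shows both that W(t) / t
   has a limit SM(K) as t -> 0+ and that W(t) <= SM(K) t + 16 t^2. The last inequality, uniform in K,
   passes to Hausdorff limits.

   The area inequality is first proved for Minkowski sums of K with two segments in place of two discs.
   By linearity the segments may be taken to be the coordinate unit vectors, and after replacing K by
   small pixels the inequality says that the Euler characteristic of a connected pixel set is at most 1.
   It is additive in each summand, hence extends to sums of segments (zonotopes), which approximate
   discs. *)
theory Submission imports Defs "HOL-Complex_Analysis.Great_Picard" begin

section \<open>The Euler characteristic of a connected pixel set\<close>

text \<open>Two limits must be exchanged: the content is a limit in \<open>t\<close>, and the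
  continua themselves converge. Area is moreover only upper semicontinuous under Hausdorff
  convergence. The bound V(t) <= V(0) + L t + 16 t^2 meets both obstacles: it concerns a fixed
  \<open>t\<close>, and the area of the approximating continuum stands on the larger side, where
  upper semicontinuity suffices. Connectedness enters the area inequality through the Euler
  characteristic: with several components the bound 1 would become their number, and no error term
  uniform in K would result. Segments replace discs because a pair of independent segments is
  carried by a linear map to the coordinate directions, where sums with segments become shifts of
  pixels. The 16 is 4 * 4: a unit disc is approximated by zonotopes whose segments have total length
  at most 4, and two segments contribute at most the product of their lengths. Any constant
  independent of K would serve, since the error vanishes after division by \<open>t\<close> as
  \<open>t\<close> -> 0.\<close>

definition grow :: "nat \<Rightarrow> nat \<Rightarrow> (int \<times> int) set \<Rightarrow> (int \<times> int) set" where
  "grow m n P = (\<lambda>((x, y), (a, b)). (x + a, y + b)) ` (P \<times> ({0..int m} \<times> {0..int n}))"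

text \<open>The eight neighbours and the pixel itself: exactly the cases in which the closed unit
  squares meet, possibly only at a corner. This is the adjacency that matches an Euler
  characteristic counting closed pixels.\<close>

definition king_adjacent :: "int \<times> int \<Rightarrow> int \<times> int \<Rightarrow> bool" where
  "king_adjacent p q \<longleftrightarrow> \<bar>fst p - fst q\<bar> \<le> 1 \<and> \<bar>snd p - snd q\<bar> \<le> 1"

lemma king_adjacent_commute: "king_adjacent p q \<longleftrightarrow> king_adjacent q p"
  by (auto simp: king_adjacent_def)

definition king_labelling :: "(int \<times> int) set \<Rightarrow> (int \<times> int \<Rightarrow> int) \<Rightarrow> bool" where
  "king_labelling P f \<longleftrightarrow> (\<forall>p\<in>P. \<forall>q\<in>P. king_adjacent p q \<longrightarrow> f p = f q)"

lemma king_labelling_insertI: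
  assumes P: "\<And>q q'. q \<in> P \<Longrightarrow> q' \<in> P \<Longrightarrow> king_adjacent q q' \<Longrightarrow> g q = g q'"
    and p: "\<And>q. q \<in> P \<Longrightarrow> king_adjacent p q \<Longrightarrow> g q = g p"
  shows "king_labelling (insert p P) g"
  unfolding king_labelling_def
proof (intro ballI impI)
  fix q q' assume q: "q \<in> insert p P" "q' \<in> insert p P" "king_adjacent q q'"
  consider "q = p" "q' = p" | "q = p" "q' \<in> P" | "q \<in> P" "q' = p" | "q \<in> P" "q' \<in> P"
    using q by blast
  then show "g q = g q'"
  proof cases
    case 2
    with p[of q'] q(3) show ?thesis by simp
  next
    case 3
    with p[of q] q(3) show ?thesis by (simp add: king_adjacent_commute)
  next
    case 4
    with P[of q q'] q(3) show ?thesis by simp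
  qed simp
qed

text \<open>Connectedness is phrased through labellings, which turns component counting into counting labels.\<close>

definition king_connected :: "(int \<times> int) set \<Rightarrow> bool" where
  "king_connected P \<longleftrightarrow> (\<forall>f. king_labelling P f \<longrightarrow> (\<forall>p\<in>P. \<forall>q\<in>P. f p = f q))"

text \<open>Identifying a pixel with its lower left corner, the vertices, vertical edges and horizontal edges of
  the union of the closed pixels are counted by the three \<open>grow\<close> terms.\<close>

definition pixel_euler :: "(int \<times> int) set \<Rightarrow> int" where
  "pixel_euler P = int (card (grow 1 1 P)) - int (card (grow 1 0 P)) - int (card (grow 0 1 P)) + int (card P)"

lemma mem_grow: "(x, y) \<in> grow m n P \<longleftrightarrow> (\<exists>a b. 0 \<le> a \<and> a \<le> int m \<and> 0 \<le> b \<and> b \<le> int n \<and> (x - a, y - b) \<in> P)"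
proof
  assume "(x, y) \<in> grow m n P"
  then show "\<exists>a b. 0 \<le> a \<and> a \<le> int m \<and> 0 \<le> b \<and> b \<le> int n \<and> (x - a, y - b) \<in> P"
    by (auto simp: grow_def) fastforce
next
  assume "\<exists>a b. 0 \<le> a \<and> a \<le> int m \<and> 0 \<le> b \<and> b \<le> int n \<and> (x - a, y - b) \<in> P"
  then obtain a b where "0 \<le> a" "a \<le> int m" "0 \<le> b" "b \<le> int n" "(x - a, y - b) \<in> P" by blast
  then show "(x, y) \<in> grow m n P"
    unfolding grow_def by (intro image_eqI[where x = "((x - a, y - b), (a, b))"]) auto
qed

lemma finite_grow: "finite P \<Longrightarrow> finite (grow m n P)"
  by (simp add: grow_def)

lemma int_interval_split:
  fixes c :: int
  assumes "0 \<le> c" "c \<le> int m + int k"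
  obtains a where "0 \<le> a" "a \<le> int m" "0 \<le> c - a" "c - a \<le> int k"
  using assms that[of "min c (int m)"] by (auto simp: min_def split: if_splits)

text \<open>Lattice intervals add by adding their lengths. Hence the Euler characteristic of a grown
  set becomes a mixed second difference of \<open>card (grow k l P)\<close>.\<close>

lemma grow_grow: "grow m n (grow k l P) = grow (m + k) (n + l) P"
proof (intro set_eqI iffI; clarify)
  fix x y assume "(x, y) \<in> grow m n (grow k l P)"
  then obtain a b c d where "0 \<le> a" "a \<le> int m" "0 \<le> b" "b \<le> int n"
     "0 \<le> c" "c \<le> int k" "0 \<le> d" "d \<le> int l" "(x - a - c, y - b - d) \<in> P"
    by (auto simp: mem_grow)
  then show "(x, y) \<in> grow (m + k) (n + l) P"
    unfolding mem_grow by (intro exI[of _ "a + c"] exI[of _ "b + d"]) (auto simp: algebra_simps)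
next
  fix x y assume "(x, y) \<in> grow (m + k) (n + l) P"
  then obtain c d where c: "0 \<le> c" "c \<le> int m + int k" "0 \<le> d" "d \<le> int n + int l" "(x - c, y - d) \<in> P"
    by (auto simp: mem_grow)
  obtain a where a: "0 \<le> a" "a \<le> int m" "0 \<le> c - a" "c - a \<le> int k"
    using int_interval_split c by blast
  obtain b where b: "0 \<le> b" "b \<le> int n" "0 \<le> d - b" "d - b \<le> int l"
    using int_interval_split c by blast
  have "(x - a, y - b) \<in> grow k l P"
    unfolding mem_grow using a b c by (intro exI[of _ "c - a"] exI[of _ "d - b"]) auto
  then show "(x, y) \<in> grow m n (grow k l P)"
    unfolding mem_grow[of x y m n] using a b by blast
qed

lemma grow_0_0 [simp]: "grow 0 0 P = P"
  by (force simp: grow_def)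

lemma king_connected_grow_step:
  assumes P: "king_connected P" and mn: "m \<le> 1" "n \<le> 1"
  shows "king_connected (grow m n P)"
  unfolding king_connected_def
proof (intro allI impI)
  fix f assume f: "king_labelling (grow m n P) f"
  have sub: "P \<subseteq> grow m n P" by (auto simp: mem_grow intro!: exI[of _ 0])
  then have "king_labelling P f" using f by (auto simp: king_labelling_def)
  then have const: "\<And>p q. p \<in> P \<Longrightarrow> q \<in> P \<Longrightarrow> f p = f q"
    using P by (auto simp: king_connected_def)
  have "\<exists>q\<in>P. f p = f q" if "p \<in> grow m n P" for p
  proof -
    obtain x y where p: "p = (x, y)" by fastforce
    with that obtain a b where ab: "0 \<le> a" "a \<le> int m" "0 \<le> b" "b \<le> int n" and "(x - a, y - b) \<in> P"
      by (auto simp: mem_grow)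
    moreover have "king_adjacent p (x - a, y - b)"
      using ab mn by (auto simp: p king_adjacent_def)
    ultimately show ?thesis using f that sub by (auto simp: king_labelling_def)
  qed
  then show "\<forall>p\<in>grow m n P. \<forall>q\<in>grow m n P. f p = f q"
    using const by metis
qed

lemma king_connected_grow:
  assumes "king_connected P"
  shows "king_connected (grow m n P)"
proof -
  have 1: "king_connected (grow m 0 P)"
  proof (induction m)
    case (Suc m)
    then show ?case using king_connected_grow_step[OF Suc, of 1 0] by (simp add: grow_grow)
  qed (use assms in simp)
  show ?thesis
  proof (induction n)
    case (Suc n)
    then show ?case using king_connected_grow_step[OF Suc, of 0 1] by (simp add: grow_grow)
  qed (use 1 in simp)
qed

lemma mem_grow_unit:
  "(x, y) \<in> grow 1 1 P \<longleftrightarrow> (x, y) \<in> P \<or> (x, y - 1) \<in> P \<or> (x - 1, y) \<in> P \<or> (x - 1, y - 1) \<in> P"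
  "(x, y) \<in> grow 1 0 P \<longleftrightarrow> (x, y) \<in> P \<or> (x - 1, y) \<in> P"
  "(x, y) \<in> grow 0 1 P \<longleftrightarrow> (x, y) \<in> P \<or> (x, y - 1) \<in> P"
proof -
  have i0: "(0 \<le> a \<and> a \<le> int 0) \<longleftrightarrow> a = 0" and i1: "(0 \<le> a \<and> a \<le> int 1) \<longleftrightarrow> a = 0 \<or> a = 1" for a by auto
  have "(x, y) \<in> grow m n P \<longleftrightarrow> (\<exists>a b. (0 \<le> a \<and> a \<le> int m) \<and> (0 \<le> b \<and> b \<le> int n) \<and> (x - a, y - b) \<in> P)" for m n
    by (simp add: mem_grow)
  note eq = this[of 1 1, unfolded i0 i1] this[of 1 0, unfolded i0 i1] this[of 0 1, unfolded i0 i1]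
  show "(x, y) \<in> grow 1 1 P \<longleftrightarrow> (x, y) \<in> P \<or> (x, y - 1) \<in> P \<or> (x - 1, y) \<in> P \<or> (x - 1, y - 1) \<in> P"
    by (simp add: eq conj_disj_distribR ex_disj_distrib disj_assoc del: One_nat_def)
  show "(x, y) \<in> grow 1 0 P \<longleftrightarrow> (x, y) \<in> P \<or> (x - 1, y) \<in> P"
    by (simp add: eq conj_disj_distribR ex_disj_distrib disj_assoc del: One_nat_def)
  show "(x, y) \<in> grow 0 1 P \<longleftrightarrow> (x, y) \<in> P \<or> (x, y - 1) \<in> P"
    by (simp add: eq conj_disj_distribR ex_disj_distrib disj_assoc del: One_nat_def)
qed

lemma grow_insert:
  "grow 1 1 (insert (x, y) P) = insert (x, y) (insert (x + 1, y) (insert (x, y + 1) (insert (x + 1, y + 1) (grow 1 1 P))))"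
  "grow 1 0 (insert (x, y) P) = insert (x, y) (insert (x + 1, y) (grow 1 0 P))"
  "grow 0 1 (insert (x, y) P) = insert (x, y) (insert (x, y + 1) (grow 0 1 P))"
proof -
  have i: "a - 1 = c \<longleftrightarrow> a = c + 1" for a c :: int by auto
  show "grow 1 1 (insert (x, y) P) = insert (x, y) (insert (x + 1, y) (insert (x, y + 1) (insert (x + 1, y + 1) (grow 1 1 P))))"
    by (intro set_eqI, clarify, simp only: mem_grow_unit insert_iff prod.inject i) argo
  show "grow 1 0 (insert (x, y) P) = insert (x, y) (insert (x + 1, y) (grow 1 0 P))"
    by (intro set_eqI, clarify, simp only: mem_grow_unit insert_iff prod.inject i) argo
  show "grow 0 1 (insert (x, y) P) = insert (x, y) (insert (x, y + 1) (grow 0 1 P))"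
    by (intro set_eqI, clarify, simp only: mem_grow_unit insert_iff prod.inject i) argo
qed

text \<open>The change is 1 minus the number of components of the intersection of the new closed
  pixel with the earlier ones. In this order the top and right edges are always new, so each
  component is a point or an arc. A pixel below joins everything into one arc; otherwise there are
  at most two components, one at the lower right corner and one at the left.\<close>

lemma pixel_euler_insert:
  assumes "finite P"
    and above: "\<And>x' y'. (x', y') \<in> P \<Longrightarrow> y' < y \<or> (y' = y \<and> x' < x)"
  shows "pixel_euler (insert (x, y) P) = pixel_euler P +
    (if (x, y - 1) \<in> P then 0
     else (if (x + 1, y - 1) \<in> P then 0 else 1) + (if (x - 1, y) \<in> P \<or> (x - 1, y - 1) \<in> P then 0 else 1) - 1)"
proof -
  have n: "(x, y) \<notin> P" "(x + 1, y) \<notin> P" "(x, y + 1) \<notin> P" "(x + 1, y + 1) \<notin> P" "(x - 1, y + 1) \<notin> P"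
    using above by force+
  have "finite (grow 1 1 P)" "finite (grow 1 0 P)" "finite (grow 0 1 P)"
    using assms(1) by (auto intro: finite_grow)
  then show ?thesis
    using assms(1) n by (simp add: pixel_euler_def grow_insert card_insert_if mem_grow_unit del: One_nat_def)
qed

lemma finite_int_prod_max_induct [consumes 1, case_names empty insert]:
  fixes P :: "(int \<times> int) set"
  assumes "finite P" and "Q {}"
    and step: "\<And>x y P. finite P \<Longrightarrow> (\<And>x' y'. (x', y') \<in> P \<Longrightarrow> y' < y \<or> (y' = y \<and> x' < x)) \<Longrightarrow> Q P \<Longrightarrow> Q (insert (x, y) P)"
  shows "Q P"
  using assms(1)
proof (induction "card P" arbitrary: P)
  case 0
  then show ?case using assms(2) by simp
next
  case (Suc k)
  then have ne: "P \<noteq> {}" by auto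
  define y where "y = Max (snd ` P)"
  define X where "X = {x. (x, y) \<in> P}"
  have y: "y \<in> snd ` P" "\<And>p. p \<in> P \<Longrightarrow> snd p \<le> y"
    using Suc.prems ne by (auto simp: y_def)
  have X: "finite X"
    by (rule finite_subset[of _ "fst ` P"]) (use Suc.prems in \<open>force simp: X_def\<close>)+
  have "X \<noteq> {}" using y(1) by (force simp: X_def)
  then have "Max X \<in> X" and mx: "\<And>x. x \<in> X \<Longrightarrow> x \<le> Max X" using X by auto
  then have mem: "(Max X, y) \<in> P" by (simp add: X_def)
  let ?P = "P - {(Max X, y)}"
  have "Q (insert (Max X, y) ?P)"
  proof (rule step)
    show "finite ?P" using Suc.prems by simp
    have "k = card ?P" using Suc.hyps(2) mem Suc.prems by simp
    then show "Q ?P" using Suc.hyps(1) Suc.prems by blast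
    fix x' y' assume a: "(x', y') \<in> ?P"
    then have "y' \<le> y" using y(2) by force
    moreover have "x' < Max X" if "y' = y"
      using mx[of x'] a that by (cases "x' = Max X") (auto simp: X_def)
    ultimately show "y' < y \<or> (y' = y \<and> x' < Max X)" by force
  qed
  then show ?case using mem by (simp add: insert_absorb)
qed

text \<open>Adding pixels in lexicographic order, the Euler characteristic never grows by more than the number
  of components; in an arbitrary order this fails when a pixel fills a hole.\<close>

lemma pixel_euler_le_labels:
  assumes "finite P"
  shows "\<exists>f. king_labelling P f \<and> pixel_euler P \<le> int (card (f ` P))"
  using assms
proof (induction rule: finite_int_prod_max_induct)
  case empty
  then show ?case by (auto simp: king_labelling_def pixel_euler_def grow_def)
next
  case (insert x y P)
  from insert.IH obtain f where f: "king_labelling P f" and chi: "pixel_euler P \<le> int (card (f ` P))" by blast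
  have new: "(x, y) \<notin> P" using insert.hyps(2) by blast
  have nb: "q \<in> {(x - 1, y), (x - 1, y - 1), (x, y - 1), (x + 1, y - 1)}"
    if "q \<in> P" "king_adjacent (x, y) q \<or> king_adjacent q (x, y)" for q
    using insert.hyps(2)[of "fst q" "snd q"] that
    by (cases q) (auto simp: king_adjacent_def)
  have lab: "f p = f q" if "p \<in> P" "q \<in> P" "king_adjacent p q" for p q
    using f that by (auto simp: king_labelling_def)
  note euler = pixel_euler_insert[OF insert.hyps]
  have fin: "finite (f ` P)" using insert.hyps by simp
  show ?case
  proof (cases "\<exists>c. \<forall>q\<in>P. king_adjacent (x, y) q \<longrightarrow> f q = c")
    case one_label: True
    show ?thesis
    proof (cases "\<exists>q\<in>P. king_adjacent (x, y) q")
      case True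
      then obtain q where q: "q \<in> P" "king_adjacent (x, y) q" by blast
      define g where "g = f((x, y) := f q)"
      have gf: "g p = f p" if "p \<in> P" for p using that new by (auto simp: g_def)
      have "king_labelling (insert (x, y) P) g"
      proof (rule king_labelling_insertI)
        fix p assume p: "p \<in> P" "king_adjacent (x, y) p"
        then have "f p = f q" using one_label q by metis
        then show "g p = g (x, y)" using gf p by (simp add: g_def)
      next
        fix p p' assume "p \<in> P" "p' \<in> P" "king_adjacent p p'"
        then show "g p = g p'" using lab[of p p'] gf[of p] gf[of p'] by simp
      qed
      moreover have "g ` insert (x, y) P = f ` P"
        using q new by (auto simp: g_def)
      moreover have "pixel_euler (insert (x, y) P) \<le> pixel_euler P"
        using nb[OF q(1)] q euler by auto
      ultimately show ?thesis using chi by (intro exI[of _ g]) auto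
    next
      case False
      \<comment> \<open>No earlier pixel touches the new one, so it starts a component, and the
        fresh label matches the increase by one.\<close>
      obtain c where c: "c \<notin> f ` P" using fin by (meson ex_new_if_finite infinite_UNIV_int)
      define g where "g = f((x, y) := c)"
      have gf: "g p = f p" if "p \<in> P" for p using that new by (auto simp: g_def)
      have "king_labelling (insert (x, y) P) g"
      proof (rule king_labelling_insertI)
        fix p assume "p \<in> P" "king_adjacent (x, y) p"
        then show "g p = g (x, y)" using False by blast
      next
        fix p p' assume "p \<in> P" "p' \<in> P" "king_adjacent p p'"
        then show "g p = g p'" using lab[of p p'] gf[of p] gf[of p'] by simp
      qed
      moreover have "g ` insert (x, y) P = insert c (f ` P)"
        using new by (auto simp: g_def)
      moreover have "pixel_euler (insert (x, y) P) \<le> pixel_euler P + 1"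
        using euler by auto
      ultimately show ?thesis using chi c fin by (intro exI[of _ g]) auto
    qed
  next
    case False
    let ?l = "(x - 1, y)" and ?bl = "(x - 1, y - 1)" and ?b = "(x, y - 1)" and ?br = "(x + 1, y - 1)"
    \<comment> \<open>Every possible earlier neighbour is within a king move of the pixel below,
      whose presence would therefore force a single label.\<close>
    have nb_b: "?b \<notin> P"
    proof
      assume b: "?b \<in> P"
      have "\<forall>q\<in>P. king_adjacent (x, y) q \<longrightarrow> f q = f ?b"
      proof (intro ballI impI)
        fix q assume q: "q \<in> P" "king_adjacent (x, y) q"
        show "f q = f ?b"
          by (rule lab[OF q(1) b]) (use nb[OF q(1)] q(2) in \<open>auto simp: king_adjacent_def\<close>)
      qed
      then have "\<exists>c. \<forall>q\<in>P. king_adjacent (x, y) q \<longrightarrow> f q = c" by (rule exI)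
      with False show False by (rule notE)
    qed
    \<comment> \<open>\<open>?l\<close> and \<open>?bl\<close> touch each other and share a label,
      so a second label can only come from \<open>?br\<close>.\<close>
    have br: "?br \<in> P"
    proof (rule ccontr)
      assume "?br \<notin> P"
      then have cand: "q = ?l \<or> q = ?bl" if "q \<in> P" "king_adjacent (x, y) q" for q
        using nb[OF that(1) disjI1[OF that(2)]] that(1) nb_b by (elim insertE emptyE) simp_all
      have "\<exists>c. \<forall>q\<in>P. king_adjacent (x, y) q \<longrightarrow> f q = c"
      proof (cases "?l \<in> P")
        case True
        have "\<forall>q\<in>P. king_adjacent (x, y) q \<longrightarrow> f q = f ?l"
        proof (intro ballI impI)
          fix q assume q: "q \<in> P" "king_adjacent (x, y) q"
          show "f q = f ?l"
            by (rule lab[OF q(1) True]) (use cand[OF q] in \<open>auto simp: king_adjacent_def\<close>)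
        qed
        then show ?thesis by (rule exI)
      next
        case False
        have "\<forall>q\<in>P. king_adjacent (x, y) q \<longrightarrow> f q = f ?bl"
        proof (intro ballI impI)
          fix q assume q: "q \<in> P" "king_adjacent (x, y) q"
          then have "q = ?bl" using cand[OF q] False by (elim disjE) simp_all
          then show "f q = f ?bl" by simp
        qed
        then show ?thesis by (rule exI)
      qed
      with False show False by (rule notE)
    qed
    obtain q where q: "q \<in> P" "q = ?l \<or> q = ?bl"
    proof -
      obtain q where q: "q \<in> P" "king_adjacent (x, y) q" "f q \<noteq> f ?br" using False by blast
      have "q = ?l \<or> q = ?bl"
        using nb[OF q(1) disjI1[OF q(2)]] q(1,3) nb_b by (elim insertE emptyE) simp_all
      then show ?thesis using q(1) that by blast
    qed
    have fq: "f q' = f q" if "q' = ?l \<or> q' = ?bl" "q' \<in> P" for q'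
      by (rule lab[OF that(2) q(1)]) (use that q in \<open>auto simp: king_adjacent_def\<close>)
    \<comment> \<open>The new pixel joins two labels, and \<open>r\<close> renames the one on the
      right to the one on the left. At most one label disappears, while the intersection with the
      earlier pixels has two components and lowers the Euler characteristic by exactly one.\<close>
    define r where "r v = (if v = f ?br then f q else v)" for v
    define g where "g = (r \<circ> f)((x, y) := f q)"
    have gq: "g q' = f q" if "q' \<in> P" "king_adjacent (x, y) q' \<or> king_adjacent q' (x, y)" for q'
    proof -
      have "q' \<noteq> (x, y)" using that new by blast
      then show ?thesis
        using nb[OF that] that(1) nb_b fq[of q'] by (elim insertE emptyE) (simp_all add: g_def r_def)
    qed
    have labels: "king_labelling (insert (x, y) P) g"
    proof (rule king_labelling_insertI)
      fix p assume "p \<in> P" "king_adjacent (x, y) p"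
      then show "g p = g (x, y)" using gq[of p] by (simp add: g_def)
    next
      fix p p' assume p: "p \<in> P" "p' \<in> P" "king_adjacent p p'"
      then have "p \<noteq> (x, y)" "p' \<noteq> (x, y)" using new by blast+
      then show "g p = g p'" using p lab[of p p'] by (simp add: g_def)
    qed
    have "f ` P \<subseteq> insert (f ?br) (g ` insert (x, y) P)"
    proof
      fix v assume "v \<in> f ` P"
      then obtain p where p: "p \<in> P" "v = f p" by blast
      then show "v \<in> insert (f ?br) (g ` insert (x, y) P)"
        using new by (cases "v = f ?br") (auto simp: g_def r_def image_iff intro!: bexI[of _ p])
    qed
    then have "card (f ` P) \<le> card (insert (f ?br) (g ` insert (x, y) P))"
      using insert.hyps by (intro card_mono) auto
    also have "\<dots> \<le> Suc (card (g ` insert (x, y) P))" 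
      using insert.hyps by (simp add: card_insert_if)
    finally have "int (card (f ` P)) \<le> int (card (g ` insert (x, y) P)) + 1" by linarith
    moreover have "pixel_euler (insert (x, y) P) = pixel_euler P - 1"
      using euler nb_b br q by auto
    ultimately show ?thesis using chi labels by (intro exI[of _ g] conjI) linarith+
  qed
qed

lemma pixel_euler_le_1:
  assumes "finite P" "king_connected P"
  shows "pixel_euler P \<le> 1"
proof -
  obtain f where f: "king_labelling P f" "pixel_euler P \<le> int (card (f ` P))"
    using pixel_euler_le_labels assms by blast
  have "card (f ` P) \<le> 1"
  proof (cases "P = {}")
    case False
    then obtain p where p: "p \<in> P" by blast
    have "f ` P \<subseteq> {f p}"
    proof clarify
      fix q assume "q \<in> P"
      then show "f q = f p" using f(1) assms(2) p unfolding king_connected_def by blast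
    qed
    then show ?thesis by (metis card.empty card_insert_if card_mono finite.emptyI finite.insertI empty_iff One_nat_def)
  qed simp
  then show ?thesis using f by linarith
qed

text \<open>\<open>pixel_euler (grow k l P)\<close> is the unit mixed difference of the
  cardinalities at \<open>(k, l)\<close>. Growing preserves connectedness, so each of the m * n
  differences is at most 1, and their sum telescopes.\<close>

lemma card_grow_mixed_difference:
  assumes "finite P" "king_connected P"
  shows "int (card (grow m n P)) + int (card P) \<le> int (card (grow m 0 P)) + int (card (grow 0 n P)) + int m * int n"
proof -
  have unit: "int (card (grow (Suc k) (Suc l) P)) - int (card (grow (Suc k) l P))
      - int (card (grow k (Suc l) P)) + int (card (grow k l P)) \<le> 1" for k l
    using pixel_euler_le_1[OF finite_grow king_connected_grow, OF assms, of k l]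
    by (simp add: pixel_euler_def grow_grow)
  have row: "int (card (grow m (Suc l) P)) - int (card (grow m l P)) \<le> 
     int (card (grow 0 (Suc l) P)) - int (card (grow 0 l P)) + int m" for l
  proof (induction m)
    case (Suc k)
    then show ?case using unit[of k l] by simp
  qed simp
  show ?thesis
  proof (induction n)
    case (Suc n)
    then show ?case using row[of n] by (simp add: algebra_simps)
  qed simp
qed

section \<open>Minkowski sums with segments and zonotopes\<close>

lemma compact_set_plus:
  fixes S T :: "'a::real_normed_vector set"
  assumes "compact S" "compact T"
  shows "compact (S + T)"
proof -
  have "S + T = {x + y | x y. x \<in> S \<and> y \<in> T}" by (auto simp: set_plus_def)
  then show ?thesis using compact_sums[OF assms] by simp
qed

section \<open>Closed neighbourhoods of compact sets and their areas\<close>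

lemma closed_nbhd_iff:
  assumes "compact K" "K \<noteq> {}"
  shows "x \<in> closed_nbhd t K \<longleftrightarrow> (\<exists>k\<in>K. dist x k \<le> t)"
proof
  assume "x \<in> closed_nbhd t K"
  moreover obtain k where "k \<in> K" "infdist x K = dist x k"
    using infdist_attains_inf[of K x] assms compact_imp_closed by blast
  ultimately show "\<exists>k\<in>K. dist x k \<le> t" by (auto simp: closed_nbhd_def)
next
  assume "\<exists>k\<in>K. dist x k \<le> t"
  then show "x \<in> closed_nbhd t K"
    by (auto simp: closed_nbhd_def intro: infdist_le2)
qed

lemma compact_closed_nbhd:
  assumes "compact K" "K \<noteq> {}"
  shows "compact (closed_nbhd t K)"
proof -
  have "closed (closed_nbhd t K)"
    unfolding closed_nbhd_def by (intro closed_Collect_le continuous_intros)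
  moreover have "compact {x. infdist x K \<le> max t 1}"
    using assms by (intro compact_infdist_le) auto
  then have "bounded (closed_nbhd t K)"
    by (intro bounded_subset[OF compact_imp_bounded]) (auto simp: closed_nbhd_def)
  ultimately show ?thesis by (simp add: compact_eq_bounded_closed)
qed

lemma closed_nbhd_mono: "s \<le> t \<Longrightarrow> closed_nbhd s K \<subseteq> closed_nbhd t K"
  by (auto simp: closed_nbhd_def)

lemma subset_closed_nbhd: "0 \<le> t \<Longrightarrow> K \<subseteq> closed_nbhd t K"
  by (auto simp: closed_nbhd_def)

lemma lmeasurable_closed_nbhd:
  "compact K \<Longrightarrow> K \<noteq> {} \<Longrightarrow> closed_nbhd t K \<in> lmeasurable"
  using compact_closed_nbhd lmeasurable_compact by blast

lemma closed_nbhd_0: "compact K \<Longrightarrow> K \<noteq> {} \<Longrightarrow> closed_nbhd 0 K = K"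
  using closed_nbhd_iff[of K _ 0] by auto

lemma closed_nbhd_add:
  assumes "compact K" "K \<noteq> {}" "0 \<le> s" "0 \<le> t"
  shows "closed_nbhd (s + t) K \<subseteq> closed_nbhd s (closed_nbhd t K)"
proof
  fix x assume "x \<in> closed_nbhd (s + t) K"
  then obtain k where k: "k \<in> K" "dist x k \<le> s + t" using assms closed_nbhd_iff by blast
  have c: "compact (closed_nbhd t K)" "closed_nbhd t K \<noteq> {}"
    using compact_closed_nbhd subset_closed_nbhd[of t K] assms by auto
  show "x \<in> closed_nbhd s (closed_nbhd t K)"
  proof (cases "s + t = 0")
    case True
    then have "s = 0" "t = 0" using assms by auto
    then show ?thesis using k assms c by (auto simp: closed_nbhd_def)
  next
    case False
    \<comment> \<open>The point dividing the segment from \<open>k\<close> to \<open>x\<close> in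
      the ratio \<open>t\<close> to \<open>s\<close>, which leaves distance at most \<open>t\<close>
      to \<open>k\<close> and at most \<open>s\<close> to \<open>x\<close>.\<close>
    define y where "y = k + (t / (s + t)) *\<^sub>R (x - k)"
    have p: "s + t > 0" using False assms by simp
    have "y - k = (t / (s + t)) *\<^sub>R (x - k)" by (simp add: y_def)
    then have "dist y k = (t / (s + t)) * dist x k"
      using assms by (simp add: dist_norm)
    also have "\<dots> \<le> (t / (s + t)) * (s + t)" using k assms by (intro mult_left_mono) auto
    finally have "dist y k \<le> t" using p by simp
    then have y: "y \<in> closed_nbhd t K" using closed_nbhd_iff assms k by blast
    have "t / (s + t) = 1 - s / (s + t)" using p by (simp add: field_simps)
    then have "x - y = (s / (s + t)) *\<^sub>R (x - k)"
      by (simp add: y_def scaleR_diff_left)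
    then have "dist x y = (s / (s + t)) * dist x k"
      using assms by (simp add: dist_norm)
    also have "\<dots> \<le> (s / (s + t)) * (s + t)" using k assms by (intro mult_left_mono) auto
    finally have "dist x y \<le> s" using p by simp
    then show ?thesis using y closed_nbhd_iff[OF c] by blast
  qed
qed

text \<open>Outer regularity supplies an open superset of almost the same area, and compactness fits
  a whole closed neighbourhood inside it. Every later removal of an epsilon from a radius rests on
  this.\<close>

lemma measure_closed_nbhd_less:
  assumes "compact K" "K \<noteq> {}" "e > 0"
  obtains d where "d > 0" "measure lebesgue (closed_nbhd d K) < measure lebesgue K + e"
proof -
  have K: "K \<in> lmeasurable" using assms lmeasurable_compact by blast
  obtain T where T: "open T" "K \<subseteq> T" "T - K \<in> lmeasurable" "emeasure lebesgue (T - K) < ennreal e"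
    using sets_lebesgue_outer_open[of K e] K assms by (metis fmeasurableD)
  then have "measure lebesgue (T - K) < e"
    using assms by (metis emeasure_eq_measure2 ennreal_leI not_less)
  with K T have T': "T \<in> lmeasurable" "measure lebesgue T < measure lebesgue K + e"
    by (auto simp: measurable_measure_Diff dest!: fmeasurable_Diff_D)
  obtain d where "d > 0" "{x. infdist x K \<le> d} \<subseteq> T"
    using compact_in_open_separated[of K T] assms T by blast
  then have "measure lebesgue (closed_nbhd d K) \<le> measure lebesgue T"
    using T' lmeasurable_closed_nbhd[OF assms(1,2)] by (intro measure_mono_fmeasurable) (auto simp: closed_nbhd_def)
  then show ?thesis using that \<open>d > 0\<close> T' by fastforce
qed

lemma measure_closed_nbhd_right_continuous:
  assumes K: "compact K" "K \<noteq> {}" and "t \<ge> 0" "e > 0"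
  obtains d where "d > 0" "measure lebesgue (closed_nbhd (t + d) K) < measure lebesgue (closed_nbhd t K) + e"
proof -
  have c: "compact (closed_nbhd t K)" "closed_nbhd t K \<noteq> {}"
    using compact_closed_nbhd subset_closed_nbhd[of t K] assms by auto
  obtain d where d: "d > 0" "measure lebesgue (closed_nbhd d (closed_nbhd t K)) < measure lebesgue (closed_nbhd t K) + e"
    using measure_closed_nbhd_less[OF c \<open>e > 0\<close>] by blast
  have "measure lebesgue (closed_nbhd (t + d) K) \<le> measure lebesgue (closed_nbhd d (closed_nbhd t K))"
    using closed_nbhd_add[OF K, of d t] d assms lmeasurable_closed_nbhd[OF K] lmeasurable_closed_nbhd[OF c]
    by (intro measure_mono_fmeasurable) (auto simp: add.commute)
  then show ?thesis using that d by fastforce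
qed

section \<open>Pixel approximation of planar sets\<close>

definition pixel :: "nat \<Rightarrow> real^2 \<Rightarrow> int \<times> int" where
  "pixel N x = (\<lfloor>real N * x$1\<rfloor>, \<lfloor>real N * x$2\<rfloor>)"

definition cell_corner :: "nat \<Rightarrow> int \<times> int \<Rightarrow> real^2" where
  "cell_corner N p = vector [real_of_int (fst p) / real N, real_of_int (snd p) / real N]"

text \<open>Closed cells cover the plane and open cells are disjoint. Since both have the same area,
  counting pixels from above uses the former and counting from below the latter.\<close>

lemma measure_cell:
  assumes "N > 0"
  shows "measure lebesgue (cbox (cell_corner N p) (cell_corner N (fst p + 1, snd p + 1))) = 1 / (real N)\<^sup>2"
    and "measure lebesgue (box (cell_corner N p) (cell_corner N (fst p + 1, snd p + 1))) = 1 / (real N)\<^sup>2"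
proof -
  have "cell_corner N p \<in> cbox (cell_corner N p) (cell_corner N (fst p + 1, snd p + 1))"
    by (auto simp: mem_box_cart forall_2 cell_corner_def divide_right_mono)
  then have "measure lborel (cbox (cell_corner N p) (cell_corner N (fst p + 1, snd p + 1))) = 1 / (real N)\<^sup>2"
    by (subst content_cbox_cart) (auto simp: UNIV_2 cell_corner_def power2_eq_square diff_divide_distrib[symmetric])
  then show "measure lebesgue (cbox (cell_corner N p) (cell_corner N (fst p + 1, snd p + 1))) = 1 / (real N)\<^sup>2"
     "measure lebesgue (box (cell_corner N p) (cell_corner N (fst p + 1, snd p + 1))) = 1 / (real N)\<^sup>2"
    by (simp_all add: measure_completion measure_lborel_box_eq measure_lborel_cbox_eq)
qed

lemma mem_cell:
  assumes "N > 0"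
  shows "x \<in> box (cell_corner N p) (cell_corner N (fst p + 1, snd p + 1)) \<Longrightarrow> pixel N x = p"
    and "x \<in> cbox (cell_corner N (pixel N x)) (cell_corner N (fst (pixel N x) + 1, snd (pixel N x) + 1))"
proof -
  assume "x \<in> box (cell_corner N p) (cell_corner N (fst p + 1, snd p + 1))"
  then have "real_of_int (fst p) / N < x$1" "x$1 < (real_of_int (fst p) + 1) / N"
      "real_of_int (snd p) / N < x$2" "x$2 < (real_of_int (snd p) + 1) / N"
    by (auto simp: mem_box_cart forall_2 cell_corner_def)
  then have "\<lfloor>real N * x$1\<rfloor> = fst p" "\<lfloor>real N * x$2\<rfloor> = snd p"
    using assms by (auto simp: floor_eq_iff field_simps)
  then show "pixel N x = p" by (simp add: pixel_def)
next
  have "real_of_int \<lfloor>real N * x $ i\<rfloor> / N \<le> x $ i \<and> x $ i \<le> (real_of_int \<lfloor>real N * x $ i\<rfloor> + 1) / N" for i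
    using assms of_int_floor_le[of "real N * x $ i"] real_of_int_floor_add_one_ge[of "real N * x $ i"]
    by (auto simp: field_simps)
  then show "x \<in> cbox (cell_corner N (pixel N x)) (cell_corner N (fst (pixel N x) + 1, snd (pixel N x) + 1))"
    by (auto simp: mem_box_cart forall_2 cell_corner_def pixel_def)
qed

lemma measure_le_card_pixels:
  assumes N: "N > 0" and Q: "finite Q" "pixel N ` S \<subseteq> Q" and S: "S \<in> sets lebesgue"
  shows "measure lebesgue S \<le> card Q / (real N)\<^sup>2"
proof -
  let ?c = "\<lambda>p. cbox (cell_corner N p) (cell_corner N (fst p + 1, snd p + 1))"
  have "S \<subseteq> (\<Union>p\<in>Q. ?c p)"
    using mem_cell(2)[OF N] Q by blast
  then have "measure lebesgue S \<le> measure lebesgue (\<Union>p\<in>Q. ?c p)"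
    using Q S by (intro measure_mono_fmeasurable fmeasurable.finite_UN) auto
  also have "\<dots> \<le> (\<Sum>p\<in>Q. measure lebesgue (?c p))"
    using Q by (intro measure_UNION_le) auto
  finally show ?thesis by (simp add: measure_cell[OF N])
qed

lemma card_pixels_le_measure:
  assumes N: "N > 0" and Q: "finite Q" and T: "T \<in> lmeasurable"
    and sub: "\<And>x. pixel N x \<in> Q \<Longrightarrow> x \<in> T"
  shows "card Q / (real N)\<^sup>2 \<le> measure lebesgue T"
proof -
  let ?c = "\<lambda>p. box (cell_corner N p) (cell_corner N (fst p + 1, snd p + 1))"
  have "disjoint_family_on ?c Q"
    unfolding disjoint_family_on_def using mem_cell(1)[OF N] by blast
  then have "(\<Sum>p\<in>Q. measure lebesgue (?c p)) = measure lebesgue (\<Union>p\<in>Q. ?c p)"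
    using Q by (intro measure_finite_Union[symmetric]) (auto simp: lmeasurable_iff_integrable emeasure_eq_measure2)
  also have "\<dots> \<le> measure lebesgue T"
    using T Q mem_cell(1)[OF N] sub by (intro measure_mono_fmeasurable) (auto intro!: sets.finite_UN) 
  finally show ?thesis by (simp add: measure_cell[OF N])
qed

lemma finite_pixels:
  assumes "bounded A"
  shows "finite (pixel N ` A)"
proof -
  obtain B where B: "\<And>x. x \<in> A \<Longrightarrow> norm x \<le> B" using assms bounded_iff by blast
  define M where "M = \<lceil>real N * B\<rceil> + 1"
  have "\<lfloor>real N * x $ i\<rfloor> \<in> {-M..M}" if "x \<in> A" for x i
  proof -
    have "\<bar>x $ i\<bar> \<le> B" using component_le_norm_cart[of x i] B[OF that] by linarith
    then have "\<bar>real N * x $ i\<bar> \<le> real N * B" by (simp add: abs_mult mult_left_mono)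
    then show ?thesis unfolding M_def by simp linarith
  qed
  then have "pixel N ` A \<subseteq> {-M..M} \<times> {-M..M}" by (auto simp: pixel_def)
  then show ?thesis using finite_subset by blast
qed

text \<open>Points closer than 1 / N lie in touching pixels, so a labelling pulled back along
  \<open>pixel N\<close> is locally constant on the connected set.\<close>

lemma king_connected_pixels:
  assumes N: "N > 0" and A: "connected A"
  shows "king_connected (pixel N ` A)"
  unfolding king_connected_def
proof (intro allI impI ballI)
  fix f p q assume f: "king_labelling (pixel N ` A) f" and "p \<in> pixel N ` A" "q \<in> pixel N ` A"
  then obtain a b where ab: "a \<in> A" "p = pixel N a" "b \<in> A" "q = pixel N b" by blast
  have "(f \<circ> pixel N) a = (f \<circ> pixel N) b"
  proof (rule connected_local_const[OF A ab(1,3)], intro ballI)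
    fix x assume x: "x \<in> A"
    have "f (pixel N x) = f (pixel N y)" if "y \<in> A" "dist y x < 1 / N" for y
    proof -
      have "\<bar>\<lfloor>real N * x $ i\<rfloor> - \<lfloor>real N * y $ i\<rfloor>\<bar> \<le> 1" for i
      proof -
        have "\<bar>x $ i - y $ i\<bar> < 1 / N"
          using component_le_norm_cart[of "y - x" i] that by (simp add: dist_norm)
        then have "real N * \<bar>x $ i - y $ i\<bar> < 1"
          using N by (simp add: field_simps)
        then have "\<bar>real N * x $ i - real N * y $ i\<bar> < 1"
          by (simp add: abs_mult flip: right_diff_distrib)
        then show ?thesis by linarith
      qed
      then have "king_adjacent (pixel N x) (pixel N y)" by (simp add: king_adjacent_def pixel_def)
      moreover have "pixel N x \<in> pixel N ` A" "pixel N y \<in> pixel N ` A" using x that by auto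
      ultimately show ?thesis using f unfolding king_labelling_def by blast
    qed
    then show "\<forall>\<^sub>F y in at x within A. (f \<circ> pixel N) x = (f \<circ> pixel N) y"
      using N unfolding eventually_at by (intro exI[of _ "1 / N"]) auto
  qed
  then show "f p = f q" using ab by simp
qed

text \<open>A unit segment spans N pixels, and because N is an integer rounding adds no further one.
  So growing by exactly N steps covers the sum with the segment.\<close>

lemma floor_add_scaled:
  assumes "0 \<le> s" "s \<le> 1"
  shows "\<exists>k. 0 \<le> k \<and> k \<le> int N \<and> \<lfloor>real N * (x + s)\<rfloor> - k = \<lfloor>real N * x\<rfloor>"
proof (intro exI conjI)
  have "0 \<le> real N * s" "real N * s \<le> real N" using assms by (auto simp: mult_left_le)
  then show "0 \<le> \<lfloor>real N * (x + s)\<rfloor> - \<lfloor>real N * x\<rfloor>" "\<lfloor>real N * (x + s)\<rfloor> - \<lfloor>real N * x\<rfloor> \<le> int N"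
    by (simp_all add: distrib_left floor_mono) linarith+
qed simp

text \<open>At mesh 1 / N the mixed difference of pixel counts is at most N * N, which is area 1.
  The sets on the left are covered by their pixels. On the right the pixels must fit inside a set,
  which costs a neighbourhood of width 2 / N that disappears as N grows.\<close>

lemma measure_unit_square_sum:
  fixes A :: "(real^2) set"
  assumes A: "compact A" "connected A"
  defines "I \<equiv> \<lambda>i. closed_segment 0 (axis i 1 :: real^2)"
  shows "measure lebesgue (A + I 1 + I 2) + measure lebesgue A \<le> measure lebesgue (A + I 1) + measure lebesgue (A + I 2) + 1"
proof (cases "A = {}")
  case False
  have I: "x \<in> I i \<longleftrightarrow> (\<exists>s. 0 \<le> s \<and> s \<le> 1 \<and> x = s *\<^sub>R axis i 1)" for x i
    by (auto simp: I_def in_segment)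
  have cI: "compact (I i)" for i by (simp add: I_def)
  have c: "compact (A + I 1)" "compact (A + I 2)" "compact (A + I 1 + I 2)"
    by (intro compact_set_plus cI A)+
  have ne: "A + I i \<noteq> {}" for i using False by (auto simp: set_plus_def I_def)
  have approx: "measure lebesgue (A + I 1 + I 2) + measure lebesgue A
      \<le> measure lebesgue (closed_nbhd (2 / N) (A + I 1)) + measure lebesgue (closed_nbhd (2 / N) (A + I 2)) + 1"
    if N: "N > 0" for N :: nat
  proof -
    define P where "P = pixel N ` A"
    have P: "finite P" "king_connected P"
      using finite_pixels[OF compact_imp_bounded[OF A(1)]] king_connected_pixels[OF N A(2)] by (simp_all add: P_def)
    have N2: "(real N)\<^sup>2 > 0" using N by simp
    have "pixel N ` (A + I 1 + I 2) \<subseteq> grow N N P"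
    proof (clarsimp simp: set_plus_def I)
      fix a s t assume a: "a \<in> A" and st: "0 \<le> (s::real)" "s \<le> 1" "0 \<le> (t::real)" "t \<le> 1"
      obtain k l where "0 \<le> k" "k \<le> int N" "\<lfloor>real N * (a$1 + s)\<rfloor> - k = \<lfloor>real N * a$1\<rfloor>"
         "0 \<le> l" "l \<le> int N" "\<lfloor>real N * (a$2 + t)\<rfloor> - l = \<lfloor>real N * a$2\<rfloor>"
        using floor_add_scaled st by meson
      moreover from this have "(\<lfloor>real N * (a$1 + s)\<rfloor> - k, \<lfloor>real N * (a$2 + t)\<rfloor> - l) \<in> P"
        using a by (auto simp: P_def pixel_def)
      ultimately have "(\<lfloor>real N * (a$1 + s)\<rfloor>, \<lfloor>real N * (a$2 + t)\<rfloor>) \<in> grow N N P"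
        unfolding mem_grow by blast
      then show "pixel N (a + s *\<^sub>R axis 1 1 + t *\<^sub>R axis 2 1) \<in> grow N N P"
        by (simp add: pixel_def axis_def)
    qed
    then have 1: "measure lebesgue (A + I 1 + I 2) \<le> card (grow N N P) / (real N)\<^sup>2"
      by (rule measure_le_card_pixels[OF N finite_grow[OF P(1)]]) (intro fmeasurableD lmeasurable_compact c)
    have 2: "measure lebesgue A \<le> card P / (real N)\<^sup>2"
      by (rule measure_le_card_pixels[OF N P(1)]) (use A in \<open>auto simp: P_def intro: fmeasurableD lmeasurable_compact\<close>)
    have 3: "card (grow N 0 P) / (real N)\<^sup>2 \<le> measure lebesgue (closed_nbhd (2 / N) (A + I 1))"
    proof (rule card_pixels_le_measure[OF N finite_grow[OF P(1)]])
      show "closed_nbhd (2 / N) (A + I 1) \<in> lmeasurable" by (intro lmeasurable_closed_nbhd c ne)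
      fix x assume "pixel N x \<in> grow N 0 P"
      then obtain k a where k: "0 \<le> k" "k \<le> int N" and a: "a \<in> A"
        and eq: "\<lfloor>real N * x$1\<rfloor> - k = \<lfloor>real N * a$1\<rfloor>" "\<lfloor>real N * x$2\<rfloor> = \<lfloor>real N * a$2\<rfloor>"
        by (auto simp: pixel_def mem_grow P_def)
      define y where "y = a + (real_of_int k / N) *\<^sub>R axis 1 1"
      have "(real_of_int k / N) *\<^sub>R axis 1 1 \<in> I 1"
        unfolding I using k N by (intro exI[of _ "real_of_int k / N"]) auto
      then have "y \<in> A + I 1" unfolding y_def by (rule set_plus_intro[OF a])
      \<comment> \<open>Once the shift by \<open>k\<close> pixels is subtracted, equal floors put
        each coordinate within 1 / N; the l1 norm adds the two.\<close>
      moreover have "dist x y \<le> 2 / N"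
      proof -
        have "\<bar>real N * x$1 - real_of_int k - real N * a$1\<bar> < 1" "\<bar>real N * x$2 - real N * a$2\<bar> < 1"
          using eq by linarith+
        moreover have "real N * (x$1 - y$1) = real N * x$1 - real_of_int k - real N * a$1"
          "real N * (x$2 - y$2) = real N * x$2 - real N * a$2"
          using N by (simp_all add: y_def axis_def field_simps)
        ultimately have "real N * \<bar>x$1 - y$1\<bar> < 1" "real N * \<bar>x$2 - y$2\<bar> < 1"
          by (metis abs_mult abs_of_nat)+
        then have "real N * (\<bar>x$1 - y$1\<bar> + \<bar>x$2 - y$2\<bar>) \<le> 2" by (simp add: distrib_left)
        moreover have "dist x y \<le> \<bar>x$1 - y$1\<bar> + \<bar>x$2 - y$2\<bar>"
          using norm_le_l1_cart[of "x - y"] by (simp add: dist_norm UNIV_2)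
        ultimately have "real N * dist x y \<le> 2"
          by (meson mult_left_mono of_nat_0_le_iff order_trans)
        then show ?thesis using N by (simp add: field_simps)
      qed
      ultimately show "x \<in> closed_nbhd (2 / N) (A + I 1)" using closed_nbhd_iff[OF c(1) ne] by blast
    qed
    have 4: "card (grow 0 N P) / (real N)\<^sup>2 \<le> measure lebesgue (closed_nbhd (2 / N) (A + I 2))"
    proof (rule card_pixels_le_measure[OF N finite_grow[OF P(1)]])
      show "closed_nbhd (2 / N) (A + I 2) \<in> lmeasurable" by (intro lmeasurable_closed_nbhd c ne)
      fix x assume "pixel N x \<in> grow 0 N P"
      then obtain k a where k: "0 \<le> k" "k \<le> int N" and a: "a \<in> A"
        and eq: "\<lfloor>real N * x$2\<rfloor> - k = \<lfloor>real N * a$2\<rfloor>" "\<lfloor>real N * x$1\<rfloor> = \<lfloor>real N * a$1\<rfloor>"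
        by (auto simp: pixel_def mem_grow P_def)
      define y where "y = a + (real_of_int k / N) *\<^sub>R axis 2 1"
      have "(real_of_int k / N) *\<^sub>R axis 2 1 \<in> I 2"
        unfolding I using k N by (intro exI[of _ "real_of_int k / N"]) auto
      then have "y \<in> A + I 2" unfolding y_def by (rule set_plus_intro[OF a])
      moreover have "dist x y \<le> 2 / N"
      proof -
        have "\<bar>real N * x$2 - real_of_int k - real N * a$2\<bar> < 1" "\<bar>real N * x$1 - real N * a$1\<bar> < 1"
          using eq by linarith+
        moreover have "real N * (x$2 - y$2) = real N * x$2 - real_of_int k - real N * a$2"
          "real N * (x$1 - y$1) = real N * x$1 - real N * a$1"
          using N by (simp_all add: y_def axis_def field_simps)
        ultimately have "real N * \<bar>x$2 - y$2\<bar> < 1" "real N * \<bar>x$1 - y$1\<bar> < 1"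
          by (metis abs_mult abs_of_nat)+
        then have "real N * (\<bar>x$1 - y$1\<bar> + \<bar>x$2 - y$2\<bar>) \<le> 2" by (simp add: distrib_left)
        moreover have "dist x y \<le> \<bar>x$1 - y$1\<bar> + \<bar>x$2 - y$2\<bar>"
          using norm_le_l1_cart[of "x - y"] by (simp add: dist_norm UNIV_2)
        ultimately have "real N * dist x y \<le> 2"
          by (meson mult_left_mono of_nat_0_le_iff order_trans)
        then show ?thesis using N by (simp add: field_simps)
      qed
      ultimately show "x \<in> closed_nbhd (2 / N) (A + I 2)" using closed_nbhd_iff[OF c(2) ne] by blast
    qed
    have "int (card (grow N N P)) + int (card P) \<le> int (card (grow N 0 P)) + int (card (grow 0 N P)) + int N * int N"
      by (rule card_grow_mixed_difference[OF P])
    then have "real (card (grow N N P)) + real (card P) \<le> real (card (grow N 0 P)) + real (card (grow 0 N P)) + (real N)\<^sup>2"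
      by (simp add: power2_eq_square) (metis (mono_tags) of_int_le_iff of_int_add of_int_mult of_int_of_nat_eq)
    then have "(real (card (grow N N P)) + real (card P)) / (real N)\<^sup>2
       \<le> (real (card (grow N 0 P)) + real (card (grow 0 N P)) + (real N)\<^sup>2) / (real N)\<^sup>2"
      using N2 by (intro divide_right_mono) auto
    then show ?thesis using 1 2 3 4 N2 N by (simp add: add_divide_distrib)
  qed
  show ?thesis
  proof (rule field_le_epsilon)
    fix e :: real assume "e > 0"
    then have e: "e / 2 > 0" by simp
    obtain d1 where d1: "d1 > 0" "measure lebesgue (closed_nbhd d1 (A + I 1)) < measure lebesgue (A + I 1) + e / 2"
      using measure_closed_nbhd_less[OF c(1) ne e] by blast
    obtain d2 where d2: "d2 > 0" "measure lebesgue (closed_nbhd d2 (A + I 2)) < measure lebesgue (A + I 2) + e / 2"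
      using measure_closed_nbhd_less[OF c(2) ne e] by blast
    obtain N :: nat where N: "N > 0" "1 / real N < min d1 d2 / 2"
      using d1 d2 real_arch_invD[of "min d1 d2 / 2"] by (auto simp: inverse_eq_divide)
    then have "2 / real N \<le> d1" "2 / real N \<le> d2" by auto
    then have "measure lebesgue (closed_nbhd (2 / N) (A + I 1)) \<le> measure lebesgue (closed_nbhd d1 (A + I 1))"
      "measure lebesgue (closed_nbhd (2 / N) (A + I 2)) \<le> measure lebesgue (closed_nbhd d2 (A + I 2))"
      using lmeasurable_closed_nbhd c ne
      by (auto intro!: measure_mono_fmeasurable closed_nbhd_mono)
    then show "measure lebesgue (A + I 1 + I 2) + measure lebesgue A
       \<le> measure lebesgue (A + I 1) + measure lebesgue (A + I 2) + 1 + e"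
      using approx[OF N(1)] d1 d2 by linarith
  qed
qed (simp add: set_plus_def)

lemma connected_set_plus:
  fixes S T :: "'a::real_normed_vector set"
  assumes "connected S" "connected T"
  shows "connected (S + T)"
proof -
  have "S + T = (\<lambda>(x, y). x + y) ` (S \<times> T)" by (auto simp: set_plus_def)
  moreover have "connected ((\<lambda>(x, y). x + y) ` (S \<times> T))"
    using assms by (intro connected_continuous_image connected_Times)
      (auto simp: case_prod_unfold intro!: continuous_intros)
  ultimately show ?thesis by simp
qed

lemma linear_image_set_plus:
  assumes "linear f"
  shows "f ` (S + T) = f ` S + f ` T"
  using assms by (force simp: set_plus_def linear_add)

lemma translation_set_plus:
  fixes S T :: "'a::ab_group_add set"
  shows "S + (+) c ` T = (+) c ` (S + T)" "(+) c ` S + T = (+) c ` (S + T)"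
  by (force simp: set_plus_def ac_simps)+

section \<open>Mixed second differences of the area\<close>

definition mixed_area :: "(real^2) set \<Rightarrow> (real^2) set \<Rightarrow> (real^2) set \<Rightarrow> real" where
  "mixed_area A P Q = measure lebesgue (A + P + Q) - measure lebesgue (A + P)
     - measure lebesgue (A + Q) + measure lebesgue A"

lemma mixed_area_commute: "mixed_area A P Q = mixed_area A Q P"
  by (simp add: mixed_area_def ac_simps)

text \<open>Additivity at the price of enlarging the base set. This is why the bounds for segments
  are stated for all compact connected \<open>A\<close>: the later summands see \<open>A\<close>
  plus the earlier ones.\<close>

lemma mixed_area_add_right: "mixed_area A P (Q + R) = mixed_area A P Q + mixed_area (A + Q) P R"
  by (simp add: mixed_area_def ac_simps)

lemma mixed_area_zero_right: "mixed_area A P 0 = 0"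
  by (simp add: mixed_area_def)

lemma mixed_area_translate_right: "mixed_area A P ((+) c ` Q) = mixed_area A P Q"
  by (simp add: mixed_area_def translation_set_plus measure_translation)

text \<open>The two segments form one long segment, which splits at \<open>a\<close> into
  \<open>I\<close> and a translate of \<open>J\<close>. The two resulting parts of the sum overlap
  at least in the translate of \<open>A\<close> by \<open>a\<close>, and inclusion-exclusion gives
  the sign. This covers the case in which the linear map to coordinate directions is
  singular.\<close>

lemma mixed_area_parallel_segments:
  fixes a :: "real^2"
  assumes A: "compact A" and l: "0 \<le> l"
  shows "mixed_area A (closed_segment 0 a) (closed_segment 0 (l *\<^sub>R a)) \<le> 0"
proof -
  define I where "I = closed_segment 0 a"
  define J where "J = closed_segment 0 (l *\<^sub>R a)"
  have I: "x \<in> I \<longleftrightarrow> (\<exists>s. 0 \<le> s \<and> s \<le> 1 \<and> x = s *\<^sub>R a)" for x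
    by (auto simp: I_def in_segment)
  have J: "x \<in> J \<longleftrightarrow> (\<exists>s. 0 \<le> s \<and> s \<le> 1 \<and> x = (s * l) *\<^sub>R a)" for x
    by (auto simp: J_def in_segment)
  have c: "compact (A + I)" "compact (A + J)" "compact (A + I + J)"
    using A by (auto intro!: compact_set_plus simp: I_def J_def)
  then have c': "compact ((+) a ` (A + J))" "compact ((+) a ` A)"
    using A compact_translation by blast+
  have "A + I + J \<subseteq> (A + I) \<union> (+) a ` (A + J)"
  proof
    fix z assume "z \<in> A + I + J"
    then obtain p s t where p: "p \<in> A" and st: "0 \<le> s" "s \<le> 1" "0 \<le> t" "t \<le> 1"
      and z: "z = p + s *\<^sub>R a + (t * l) *\<^sub>R a"
      by (auto simp: set_plus_def I J)
    show "z \<in> (A + I) \<union> (+) a ` (A + J)"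
    proof (cases "s + t * l \<le> 1")
      case True
      then have "(s + t * l) *\<^sub>R a \<in> I" unfolding I using st l by (intro exI[of _ "s + t * l"]) auto
      then have "p + (s + t * l) *\<^sub>R a \<in> A + I" using p by blast
      then show ?thesis by (simp add: z algebra_simps)
    next
      case False
      have "l > 0" using False st l by (cases "l = 0") auto
      have "t * l \<le> l" using st l by (simp add: mult_left_le_one_le)
      then have "s + t * l \<le> 1 + l" using st by linarith
      then have "((s + t * l - 1) / l * l) *\<^sub>R a \<in> J"
        unfolding J using False \<open>l > 0\<close> st by (intro exI[of _ "(s + t * l - 1) / l"]) (auto simp: field_simps)
      then have "p + (s + t * l - 1) *\<^sub>R a \<in> A + J" using p \<open>l > 0\<close> by auto
      then have "a + (p + (s + t * l - 1) *\<^sub>R a) \<in> (+) a ` (A + J)" by blast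
      then show ?thesis by (simp add: z algebra_simps)
    qed
  qed
  then have "measure lebesgue (A + I + J) \<le> measure lebesgue ((A + I) \<union> (+) a ` (A + J))"
    using c c' by (intro measure_mono_fmeasurable) (auto intro: lmeasurable_compact fmeasurableD)
  also have "\<dots> = measure lebesgue (A + I) + measure lebesgue (A + J) - measure lebesgue ((A + I) \<inter> (+) a ` (A + J))"
    using c c' by (subst measure_Un3) (auto intro: lmeasurable_compact simp: measure_translation)
  finally have "measure lebesgue (A + I + J) \<le> measure lebesgue (A + I) + measure lebesgue (A + J) - measure lebesgue ((A + I) \<inter> (+) a ` (A + J))" .
  moreover have "measure lebesgue A \<le> measure lebesgue ((A + I) \<inter> (+) a ` (A + J))"
  proof -
    have "a \<in> I" "0 \<in> J" by (auto simp: I_def J_def)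
    then have "(+) a ` A \<subseteq> (A + I) \<inter> (+) a ` (A + J)"
      using set_plus_intro[of _ A a I] set_plus_intro[of _ A 0 J] by (force simp: add.commute)
    then have "measure lebesgue ((+) a ` A) \<le> measure lebesgue ((A + I) \<inter> (+) a ` (A + J))"
      using c c' by (intro measure_mono_fmeasurable) (auto intro: lmeasurable_compact fmeasurableD)
    then show ?thesis by (simp add: measure_translation)
  qed
  ultimately show ?thesis by (simp add: mixed_area_def I_def J_def)
qed

text \<open>For independent \<open>a\<close> and \<open>b\<close> the linear map sending the unit
  vectors to them multiplies all four areas by the absolute value of its determinant.\<close>

lemma mixed_area_segments:
  fixes a b :: "real^2"
  assumes A: "compact A" "connected A"
  shows "mixed_area A (closed_segment 0 a) (closed_segment 0 b) \<le> norm a * norm b"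
proof (cases "a$1 * b$2 - b$1 * a$2 = 0")
  case True
  have "a = 0 \<or> (\<exists>l. b = l *\<^sub>R a)"
  proof (cases "a$1 = 0")
    case a1: True
    show ?thesis
    proof (cases "a$2 = 0")
      case False
      then have "b = (b$2 / a$2) *\<^sub>R a" using True a1 by (auto simp: vec_eq_iff forall_2)
      then show ?thesis by blast
    qed (use a1 in \<open>auto simp: vec_eq_iff forall_2\<close>)
  next
    case False
    then have "b = (b$1 / a$1) *\<^sub>R a" using True by (auto simp: vec_eq_iff forall_2 field_simps)
    then show ?thesis by blast
  qed
  then have "mixed_area A (closed_segment 0 a) (closed_segment 0 b) \<le> 0"
  proof
    assume "a = 0"
    then show ?thesis using mixed_area_zero_right[of A "closed_segment 0 b"] 
      by (simp add: mixed_area_commute set_zero)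
  next
    assume "\<exists>l. b = l *\<^sub>R a"
    then obtain l where l: "b = l *\<^sub>R a" by blast
    show ?thesis
    proof (cases "0 \<le> l")
      case True
      then show ?thesis using mixed_area_parallel_segments[OF A(1)] l by blast
    next
      case False
      \<comment> \<open>A segment pointing the opposite way is a translate of one pointing along
        \<open>a\<close>, and areas ignore the translation.\<close>
      have "closed_segment 0 b = (+) b ` closed_segment 0 (- b)"
        using closed_segment_translation[of b 0 "- b"] by (simp add: closed_segment_commute)
      then show ?thesis
        using mixed_area_parallel_segments[OF A(1), of "- l" a] False l by (simp add: mixed_area_translate_right)
    qed
  qed
  then show ?thesis by (smt (verit) mult_nonneg_nonneg norm_ge_zero)
next
  case False
  define d where "d = a$1 * b$2 - b$1 * a$2"
  define f where "f = (\<lambda>x::real^2. x$1 *\<^sub>R a + x$2 *\<^sub>R b)"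
  have lin: "linear f" unfolding f_def
    by (auto intro!: linearI simp: algebra_simps)
  have det: "det (matrix f) = d"
    by (simp add: det_2 matrix_def f_def axis_def d_def)
  then have "inj f" using det_nz_iff_inj[OF lin] False by (simp add: d_def)
  then have "surj f" using lin linear_injective_imp_surjective by blast
  define A' where "A' = inv f ` A"
  have AA: "A = f ` A'" using \<open>surj f\<close> by (simp add: A'_def image_f_inv_f)
  have "linear (inv f)" using \<open>inj f\<close> lin
    by (simp add: inj_linear_imp_inv_linear)
  then have A': "compact A'" "connected A'"
    unfolding A'_def using A by (auto intro!: compact_continuous_image connected_continuous_image linear_continuous_on linear_conv_bounded_linear[THEN iffD1])
  define I1 where "I1 = closed_segment 0 (axis 1 1 :: real^2)"
  define I2 where "I2 = closed_segment 0 (axis 2 1 :: real^2)"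
  have f0: "f 0 = 0" "f (axis 1 1) = a" "f (axis 2 1) = b" by (auto simp: f_def axis_def)
  have seg: "closed_segment 0 a = f ` I1" "closed_segment 0 b = f ` I2"
    using closed_segment_linear_image[OF lin, of 0] by (metis f0 I1_def I2_def)+
  have m: "measure lebesgue (f ` S) = \<bar>d\<bar> * measure lebesgue S" if "compact S" for S
    using measure_linear_image[OF lin lmeasurable_compact[OF that]] det by simp
  have cI: "compact I1" "compact I2" by (auto simp: I1_def I2_def)
  have "mixed_area A (closed_segment 0 a) (closed_segment 0 b) = \<bar>d\<bar> * mixed_area A' I1 I2"
    unfolding mixed_area_def seg AA linear_image_set_plus[OF lin, symmetric]
    by (simp add: m compact_set_plus A' cI algebra_simps)
  also have "\<dots> \<le> \<bar>d\<bar> * 1"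
    using measure_unit_square_sum[OF A'] by (intro mult_left_mono) (auto simp: mixed_area_def I1_def I2_def)
  \<comment> \<open>Lagrange's identity: the product of the squared lengths is the squared
    determinant plus the squared inner product. The weaker bound by lengths is kept because it sums
    over segments to a product of total lengths.\<close>
  also have "\<dots> \<le> norm a * norm b"
  proof -
    have "(norm v)\<^sup>2 = (v$1)\<^sup>2 + (v$2)\<^sup>2" for v :: "real^2"
      unfolding power2_norm_eq_inner by (simp add: inner_vec_def sum_2 power2_eq_square)
    then have "(norm a * norm b)\<^sup>2 = ((a$1)\<^sup>2 + (a$2)\<^sup>2) * ((b$1)\<^sup>2 + (b$2)\<^sup>2)"
      by (simp add: power_mult_distrib)
    also have "\<dots> = d\<^sup>2 + (a$1 * b$1 + a$2 * b$2)\<^sup>2"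
      by (simp add: d_def power2_eq_square algebra_simps)
    finally have "d\<^sup>2 \<le> (norm a * norm b)\<^sup>2" by simp
    then have "\<bar>d\<bar> \<le> \<bar>norm a * norm b\<bar>" by (simp only: abs_le_square_iff)
    then show ?thesis by (simp add: abs_mult)
  qed
  finally show ?thesis .
qed

section \<open>Zonotopes and their support functions\<close>

definition zonotope :: "(real^2) list \<Rightarrow> (real^2) set" where
  "zonotope vs = (\<Sum>v\<leftarrow>vs. closed_segment 0 v)"

lemma zonotope_Nil [simp]: "zonotope [] = {0}"
  by (simp add: zonotope_def set_zero)

lemma zonotope_Cons [simp]: "zonotope (v # vs) = closed_segment 0 v + zonotope vs"
  by (simp add: zonotope_def)

lemma compact_zonotope: "compact (zonotope vs)"
  by (induction vs) (auto intro: compact_set_plus)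

lemma convex_zonotope: "convex (zonotope vs)"
  by (induction vs) (auto intro: convex_set_plus)

lemma mixed_area_zonotopes:
  assumes "compact A" "connected A"
  shows "mixed_area A (zonotope us) (zonotope vs) \<le> (\<Sum>u\<leftarrow>us. norm u) * (\<Sum>v\<leftarrow>vs. norm v)"
proof -
  have seg: "mixed_area A (closed_segment 0 u) (zonotope vs) \<le> norm u * (\<Sum>v\<leftarrow>vs. norm v)"
    if "compact A" "connected A" for A u
    using that
  proof (induction vs arbitrary: A)
    case Nil
    then show ?case using mixed_area_zero_right[of A "closed_segment 0 u"] by (simp add: set_zero)
  next
    case (Cons v vs)
    have "compact (A + closed_segment 0 v)" "connected (A + closed_segment 0 v)"
      using Cons.prems by (auto intro: compact_set_plus connected_set_plus)
    then have "mixed_area (A + closed_segment 0 v) (closed_segment 0 u) (zonotope vs) \<le> norm u * (\<Sum>v\<leftarrow>vs. norm v)"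
      by (rule Cons.IH)
    then show ?case
      using mixed_area_segments[OF Cons.prems, of u v] by (simp add: mixed_area_add_right distrib_left)
  qed
  have "mixed_area A (zonotope vs) (zonotope us) \<le> (\<Sum>u\<leftarrow>us. norm u) * (\<Sum>v\<leftarrow>vs. norm v)"
    using assms
  proof (induction us arbitrary: A)
    case Nil
    then show ?case using mixed_area_zero_right[of A "zonotope vs"] by (simp add: set_zero)
  next
    case (Cons u us)
    have "compact (A + closed_segment 0 u)" "connected (A + closed_segment 0 u)"
      using Cons.prems by (auto intro: compact_set_plus connected_set_plus)
    then have "mixed_area (A + closed_segment 0 u) (zonotope vs) (zonotope us) \<le> (\<Sum>u\<leftarrow>us. norm u) * (\<Sum>v\<leftarrow>vs. norm v)"
      by (rule Cons.IH)
    then show ?case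
      using seg[OF Cons.prems, of u] by (simp add: mixed_area_add_right mixed_area_commute[of A "zonotope vs"] distrib_right)
  qed
  then show ?thesis by (simp add: mixed_area_commute)
qed

lemma zonotope_scale: "zonotope (map ((*\<^sub>R) s) vs) = (*\<^sub>R) s ` zonotope vs"
proof (induction vs)
  case (Cons v vs)
  have lin: "linear ((*\<^sub>R) s :: real^2 \<Rightarrow> real^2)" by (rule linear_scale_self)
  have "closed_segment 0 (s *\<^sub>R v) = (*\<^sub>R) s ` closed_segment 0 v"
    using closed_segment_linear_image[OF lin, of 0 v] by simp
  then show ?case using Cons by (simp add: linear_image_set_plus[OF lin])
qed simp

text \<open>A linear functional is maximised on each segment separately, at \<open>v\<close> or at
  0. Together with \<open>inner_zonotope_attained\<close> this identifies the sum as the support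
  function of the zonotope.\<close>

lemma inner_zonotope_le:
  assumes "x \<in> zonotope vs"
  shows "u \<bullet> x \<le> (\<Sum>v\<leftarrow>vs. max 0 (u \<bullet> v))"
  using assms
proof (induction vs arbitrary: x)
  case (Cons v vs)
  then obtain s y where s: "0 \<le> s" "s \<le> 1" and x: "x = s *\<^sub>R v + y" and y: "y \<in> zonotope vs"
    by (auto simp: set_plus_def in_segment)
  have "s * (u \<bullet> v) \<le> max 0 (u \<bullet> v)"
  proof (cases "u \<bullet> v \<ge> 0")
    case True
    then show ?thesis using s by (simp add: mult_left_le_one_le)
  next
    case False
    then show ?thesis using s by (simp add: mult_nonneg_nonpos)
  qed
  then show ?case using Cons.IH[OF y] by (simp add: x inner_add_right)
qed simp

lemma inner_zonotope_attained:
  "\<exists>x\<in>zonotope vs. u \<bullet> x = (\<Sum>v\<leftarrow>vs. max 0 (u \<bullet> v))"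
proof (induction vs)
  case (Cons v vs)
  then obtain y where y: "y \<in> zonotope vs" "u \<bullet> y = (\<Sum>v\<leftarrow>vs. max 0 (u \<bullet> v))" by blast
  define z where "z = (if u \<bullet> v \<ge> 0 then v else 0)"
  have "z \<in> closed_segment 0 v" by (simp add: z_def)
  then have "z + y \<in> zonotope (v # vs)" using y by auto
  moreover have "u \<bullet> (z + y) = (\<Sum>v\<leftarrow>v # vs. max 0 (u \<bullet> v))"
    using y by (simp add: z_def inner_add_right)
  ultimately show ?case by blast
qed simp

text \<open>Inclusion of compact convex sets is comparison of support functions, and that of a
  centred disc is its radius times the norm. The inner disc needs convexity, through a separating
  line.\<close>

lemma zonotope_between_discs:
  assumes le: "\<And>u. (\<Sum>v\<leftarrow>vs. max 0 (u \<bullet> v)) \<le> norm u" and ge: "\<And>u. r * norm u \<le> (\<Sum>v\<leftarrow>vs. max 0 (u \<bullet> v))"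
  shows "zonotope vs \<subseteq> cball 0 1" "cball 0 r \<subseteq> zonotope vs"
proof -
  show "zonotope vs \<subseteq> cball 0 1"
  proof
    fix x assume "x \<in> zonotope vs"
    then have "x \<bullet> x \<le> norm x" using inner_zonotope_le[of x vs x] le[of x] by linarith
    then have "norm x * norm x \<le> 1 * norm x" by (simp add: dot_square_norm power2_eq_square)
    then have "norm x \<le> 1" by (metis mult_le_cancel_right_pos norm_ge_zero order_le_less zero_le_one)
    then show "x \<in> cball 0 1" by simp
  qed
  show "cball 0 r \<subseteq> zonotope vs"
  proof
    fix z :: "real^2" assume z: "z \<in> cball 0 r"
    show "z \<in> zonotope vs"
    proof (rule ccontr)
      assume "z \<notin> zonotope vs"
      then obtain a b where ab: "a \<bullet> z < b" "\<And>x. x \<in> zonotope vs \<Longrightarrow> b < a \<bullet> x"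
        using separating_hyperplane_closed_point[OF convex_zonotope compact_imp_closed[OF compact_zonotope]] by metis
      \<comment> \<open>The separation puts the zonotope on the side of large values of
        \<open>a\<close>, so the support function is evaluated at \<open>- a\<close>.\<close>
      obtain x where x: "x \<in> zonotope vs" "(- a) \<bullet> x = (\<Sum>v\<leftarrow>vs. max 0 ((- a) \<bullet> v))"
        using inner_zonotope_attained by blast
      have "r * norm a \<le> (- a) \<bullet> x" using ge[of "- a"] x by simp
      also have "\<dots> < (- a) \<bullet> z" using ab x by fastforce
      also have "\<dots> \<le> norm a * norm z" using norm_cauchy_schwarz[of "- a" z] by simp
      also have "\<dots> \<le> norm a * r" using z by (intro mult_left_mono) auto
      finally show False by (simp add: mult.commute)
    qed
  qed
qed

section \<open>Areas of parallel sets and outer Minkowski content\<close>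

lemma abs_cos_plus_abs_sin_ge_1: "1 \<le> \<bar>cos x\<bar> + \<bar>sin x\<bar>" for x :: real
proof -
  have "(cos x)\<^sup>2 \<le> \<bar>cos x\<bar>" "(sin x)\<^sup>2 \<le> \<bar>sin x\<bar>"
    using mult_left_le_one_le[of "\<bar>cos x\<bar>" "\<bar>cos x\<bar>"] mult_left_le_one_le[of "\<bar>sin x\<bar>" "\<bar>sin x\<bar>"]
    by (simp_all add: power2_eq_square)
  then show ?thesis using sin_cos_squared_add[of x] by linarith
qed

lemma abs_cos_diff_le: "\<bar>cos x - cos y\<bar> \<le> \<bar>x - y\<bar>" for x y :: real
proof -
  have "\<bar>cos x - cos y\<bar> = 2 * (\<bar>sin ((x + y) / 2)\<bar> * \<bar>sin ((y - x) / 2)\<bar>)"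
    by (simp add: cos_diff_cos abs_mult)
  also have "\<dots> \<le> 2 * (1 * \<bar>(y - x) / 2\<bar>)"
    by (intro mult_left_mono mult_mono abs_sin_x_le_abs_x) auto
  finally show ?thesis by (simp add: abs_minus_commute)
qed

lemma abs_sin_diff_le: "\<bar>sin x - sin y\<bar> \<le> \<bar>x - y\<bar>" for x y :: real
  using abs_cos_diff_le[of "pi / 2 - x" "pi / 2 - y"] by (simp add: cos_diff abs_minus_commute)

text \<open>The sum over \<open>k\<close> equidistant shifts has period \<open>h\<close>, so only its oscillation over an interval of
  length \<open>h\<close> matters, where each of the \<open>k\<close> summands varies by at most \<open>2 * h\<close>.\<close>

lemma equidistant_sum_oscillation:
  fixes \<psi> :: "real \<Rightarrow> real" and k :: nat
  defines "h \<equiv> pi / 2 / real k" and "\<psi> \<equiv> \<lambda>x. \<bar>cos x\<bar> + \<bar>sin x\<bar>"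
  assumes k: "k > 0" and x: "0 \<le> x"
  shows "\<bar>(\<Sum>i<k. \<psi> (x - real i * h)) - (\<Sum>i<k. \<psi> (- real i * h))\<bar> \<le> pi"
proof -
  define S where "S x = (\<Sum>i<k. \<psi> (x - real i * h))" for x
  have h: "h > 0" "real k * h = pi / 2" using k by (auto simp: h_def)
  have per: "\<psi> (y - pi / 2) = \<psi> y" for y
    by (simp add: \<psi>_def cos_diff sin_diff)
  \<comment> \<open>A shift by \<open>h\<close> moves each summand to its neighbour. The one pushed
    out at the end returns at the other because \<open>k * h\<close> is the period pi / 2.\<close>
  have "S (y + h) = S y" for y
  proof -
    have "\<psi> (y + h) + S y = (\<Sum>i<Suc k. \<psi> (y + h - real i * h))"
      unfolding S_def by (subst sum.lessThan_Suc_shift) (simp add: algebra_simps)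
    also have "\<dots> = S (y + h) + \<psi> (y + h - pi / 2)"
      by (simp add: S_def h)
    finally show ?thesis by (simp add: per)
  qed
  then have shift: "S (y + real n * h) = S y" for y n
    by (induction n) (simp_all add: algebra_simps, metis add.assoc add.commute)
  define n where "n = nat \<lfloor>x / h\<rfloor>"
  define y where "y = x - real n * h"
  have "0 \<le> x / h" using x h by simp
  then have "real n = real_of_int \<lfloor>x / h\<rfloor>" by (simp add: n_def)
  then have "real n \<le> x / h" "x / h \<le> real n + 1" by linarith+
  then have y: "0 \<le> y" "y \<le> h" using h by (simp_all add: y_def field_simps)
  have "S x = S y" using shift[of y n] by (simp add: y_def)
  then have "\<bar>S x - S 0\<bar> = \<bar>\<Sum>i<k. \<psi> (y - real i * h) - \<psi> (0 - real i * h)\<bar>"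
    by (simp add: S_def sum_subtractf)
  also have "\<dots> \<le> (\<Sum>i<k. \<bar>\<psi> (y - real i * h) - \<psi> (0 - real i * h)\<bar>)" by (rule sum_abs)
  also have "\<dots> \<le> (\<Sum>i<k. 2 * h)"
  proof (rule sum_mono)
    fix i
    have "\<bar>\<bar>a\<bar> + \<bar>b\<bar> - (\<bar>a'\<bar> + \<bar>b'\<bar>)\<bar> \<le> 2 * \<delta>" if "\<bar>a - a'\<bar> \<le> \<delta>" "\<bar>b - b'\<bar> \<le> \<delta>" for a b a' b' \<delta> :: real
      using that by linarith
    from this[OF abs_cos_diff_le abs_sin_diff_le]
    have "\<bar>\<psi> (y - real i * h) - \<psi> (0 - real i * h)\<bar> \<le> 2 * \<bar>(y - real i * h) - (0 - real i * h)\<bar>"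
      unfolding \<psi>_def .
    then show "\<bar>\<psi> (y - real i * h) - \<psi> (0 - real i * h)\<bar> \<le> 2 * h" using y by simp
  qed
  also have "\<dots> = pi" using h by simp
  finally show ?thesis by (simp add: S_def)
qed

lemma sum_list_concat_map: "sum_list (map f (concat xss)) = (\<Sum>xs\<leftarrow>xss. \<Sum>x\<leftarrow>xs. f x)" for f :: "'a \<Rightarrow> real"
  by (induction xss) auto

text \<open>Segments in equidistant directions make the support function on unit vectors a multiple
  of the nearly constant sum \<open>S\<close>, of size at least k with oscillation bounded
  independently of k. The total length stays bounded while the relative error tends to 0.\<close>

lemma zonotope_approximates_disc:
  assumes r: "r < 1"
  obtains vs where "zonotope vs \<subseteq> cball 0 1" "cball 0 r \<subseteq> zonotope vs" "(\<Sum>v\<leftarrow>vs. norm v) \<le> 4"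
proof -
  define \<psi> where "\<psi> = (\<lambda>x. \<bar>cos x\<bar> + \<bar>sin x :: real\<bar>)"
  \<comment> \<open>On unit vectors the support function will lie between 1 - 2 * pi * c and 1,
    where c <= 1 / k. This k makes the gap at most 1 - r.\<close>
  obtain k :: nat where k': "real k > 2 * pi / (1 - r)" using reals_Archimedean2 by blast
  moreover have "2 * pi / (1 - r) > 0" using r by simp
  ultimately have k: "k > 0" by (metis of_nat_0_less_iff order_less_trans)
  have kr: "2 * pi \<le> real k * (1 - r)" using k' r by (simp add: field_simps)
  define h where "h = pi / 2 / real k"
  define S where "S x = (\<Sum>i<k. \<psi> (x - real i * h))" for x
  \<comment> \<open>\<open>S 0 + pi\<close> bounds \<open>S\<close> from above by the oscillation
    estimate, so this factor keeps the zonotope inside the unit disc.\<close>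
  define c where "c = 1 / (S 0 + pi)"
  have S0: "S 0 \<ge> real k"
    using sum_mono[of "{..<k}" "\<lambda>i. 1" "\<lambda>i. \<psi> (0 - real i * h)"] abs_cos_plus_abs_sin_ge_1
    by (simp add: S_def \<psi>_def)
  then have "S 0 + pi > 0" using pi_gt_zero of_nat_0_le_iff[of k, where ?'a = real] by linarith
  then have c: "c > 0" and cS: "c * (S 0 + pi) = 1" by (auto simp: c_def)
  define w where "w i = (vector [cos (real i * h), sin (real i * h)] :: real^2)" for i
  define w' where "w' i = (vector [- sin (real i * h), cos (real i * h)] :: real^2)" for i
  \<comment> \<open>A segment from 0 is not centred. Adding the opposite one symmetrises it and
    turns \<open>max 0\<close> into an absolute value; the perpendicular direction \<open>w'\<close>
    supplies the sine in \<open>\<psi>\<close>.\<close>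
  define vs where "vs = concat (map (\<lambda>i. [c *\<^sub>R w i, - (c *\<^sub>R w i), c *\<^sub>R w' i, - (c *\<^sub>R w' i)]) [0..<k])"
  have supp: "(\<Sum>v\<leftarrow>vs. max 0 (u \<bullet> v)) = c * (\<Sum>i<k. \<bar>u \<bullet> w i\<bar> + \<bar>u \<bullet> w' i\<bar>)" for u
  proof -
    have m: "max 0 t + max 0 (- t) = \<bar>t\<bar>" for t :: real by simp
    have "(\<Sum>v\<leftarrow>[c *\<^sub>R w i, - (c *\<^sub>R w i), c *\<^sub>R w' i, - (c *\<^sub>R w' i)]. max 0 (u \<bullet> v)) = c * (\<bar>u \<bullet> w i\<bar> + \<bar>u \<bullet> w' i\<bar>)" for i
      using m[of "c * (u \<bullet> w i)"] m[of "c * (u \<bullet> w' i)"] c by (simp add: abs_mult distrib_left)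
    then show ?thesis
      unfolding vs_def sum_list_concat_map map_map o_def
      by (simp add: sum_distrib_left interv_sum_list_conv_sum_set_nat atLeast0LessThan)
  qed
  have polar: "\<exists>x\<ge>0. (\<Sum>v\<leftarrow>vs. max 0 (u \<bullet> v)) = norm u * (c * S x)" for u :: "real^2"
  proof (cases "u = 0")
    case False
    have n: "(norm u)\<^sup>2 = (u$1)\<^sup>2 + (u$2)\<^sup>2"
      unfolding power2_norm_eq_inner by (simp add: inner_vec_def sum_2 power2_eq_square)
    have "(u$1 / norm u)\<^sup>2 + (u$2 / norm u)\<^sup>2 = 1"
      using False by (simp add: power_divide n[symmetric] add_divide_distrib[symmetric])
    then obtain x where x: "0 \<le> x" "u$1 / norm u = cos x" "u$2 / norm u = sin x"
      using sincos_total_2pi by blast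
    then have u: "u$1 = norm u * cos x" "u$2 = norm u * sin x" using False by (auto simp: field_simps)
    have "u \<bullet> w i = norm u * cos (x - real i * h)" "u \<bullet> w' i = norm u * sin (x - real i * h)" for i
      by (simp_all add: inner_vec_def sum_2 w_def w'_def u cos_diff sin_diff algebra_simps)
    then have "\<bar>u \<bullet> w i\<bar> + \<bar>u \<bullet> w' i\<bar> = norm u * \<psi> (x - real i * h)" for i
      by (simp add: \<psi>_def abs_mult distrib_left)
    then show ?thesis using x by (intro exI[of _ x]) (simp add: supp S_def sum_distrib_left mult.left_commute)
  qed (auto intro!: exI[of _ 0] simp: supp)
  have osc: "\<bar>S x - S 0\<bar> \<le> pi" if "x \<ge> 0" for x
    using equidistant_sum_oscillation[OF k that] by (simp add: S_def \<psi>_def h_def)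
  have upper: "(\<Sum>v\<leftarrow>vs. max 0 (u \<bullet> v)) \<le> norm u" for u
  proof -
    obtain x where x: "x \<ge> 0" and eq: "(\<Sum>v\<leftarrow>vs. max 0 (u \<bullet> v)) = norm u * (c * S x)" using polar by blast
    have "c * S x \<le> c * (S 0 + pi)" using osc[OF x] c by (intro mult_left_mono) auto
    then have "c * S x \<le> 1" using cS by simp
    then show ?thesis unfolding eq by (simp add: mult_left_le)
  qed
  have lower: "r * norm u \<le> (\<Sum>v\<leftarrow>vs. max 0 (u \<bullet> v))" for u
  proof -
    obtain x where x: "x \<ge> 0" and eq: "(\<Sum>v\<leftarrow>vs. max 0 (u \<bullet> v)) = norm u * (c * S x)" using polar by blast
    have "c * (S 0 - pi) \<le> c * S x" using osc[OF x] c by (intro mult_left_mono) auto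
    moreover have "c * (S 0 - pi) = 1 - c * (2 * pi)" using cS by (simp add: algebra_simps)
    moreover have "c * (2 * pi) \<le> 1 - r"
    proof -
      have "2 * pi \<le> (S 0 + pi) * (1 - r)"
        using kr mult_right_mono[of "real k" "S 0 + pi" "1 - r"] S0 r pi_gt_zero by linarith
      then have "c * (2 * pi) \<le> c * ((S 0 + pi) * (1 - r))" using c by (intro mult_left_mono) auto
      then show ?thesis using cS by (simp add: mult.assoc[symmetric])
    qed
    ultimately have "r \<le> c * S x" by linarith
    then show ?thesis unfolding eq by (metis mult.commute mult_left_mono norm_ge_zero)
  qed
  have "norm (w i) = 1" "norm (w' i) = 1" for i
    by (simp_all add: norm_eq_1 inner_vec_def sum_2 w_def w'_def power2_eq_square[symmetric])
  \<comment> \<open>Since \<open>\<psi>\<close> is at least 1, \<open>S 0\<close> is at least k and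
    hence k * c <= 1. The resulting 4 enters the area inequality squared.\<close>
  then have "(\<Sum>v\<leftarrow>vs. norm v) = 4 * (real k * c)"
    unfolding vs_def sum_list_concat_map map_map o_def
    using c by (simp add: sum_list_triv)
  also have "\<dots> \<le> 4 * ((S 0 + pi) * c)"
    using S0 c pi_gt_zero by (intro mult_left_mono mult_right_mono) linarith+
  also have "\<dots> = 4" using cS by (simp add: mult.commute)
  finally show ?thesis using that zonotope_between_discs[OF upper lower] by blast
qed

text \<open>Discs on the left are enlarged to zonotopes, and zonotopes on the right to discs with
  radii multiplied by \<open>l\<close>. Area is right-continuous in the radius, so letting
  \<open>l\<close> tend to 1 removes the loss.\<close>

lemma measure_closed_nbhd_subadditive:
  assumes K: "continuum K" and st: "0 \<le> s" "0 \<le> t"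
  shows "measure lebesgue (closed_nbhd (s + t) K) + measure lebesgue K
    \<le> measure lebesgue (closed_nbhd s K) + measure lebesgue (closed_nbhd t K) + 16 * s * t"
proof -
  have K: "compact K" "connected K" "K \<noteq> {}" using K by (auto simp: continuum_def)
  note lm = lmeasurable_closed_nbhd[OF K(1,3)]
  have approx: "measure lebesgue (closed_nbhd (s + t) K) + measure lebesgue K
    \<le> measure lebesgue (closed_nbhd (l * s) K) + measure lebesgue (closed_nbhd (l * t) K) + 16 * (l * s) * (l * t)"
    if l: "l > 1" for l
  proof -
    have "1 / l < 1" using l by simp
    then obtain vs where vs: "zonotope vs \<subseteq> cball 0 1" "cball 0 (1 / l) \<subseteq> zonotope vs" "(\<Sum>v\<leftarrow>vs. norm v) \<le> 4"
      using zonotope_approximates_disc by blast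
    \<comment> \<open>The factor \<open>l\<close> turns the inner radius 1 / l into \<open>a\<close>
      and the outer radius 1 into \<open>l * a\<close>.\<close>
    define Z where "Z a = zonotope (map ((*\<^sub>R) (l * a)) vs)" for a
    have Zsup: "v \<in> Z a" if "norm v \<le> a" "0 \<le> a" for v a
    proof (cases "a = 0")
      case True
      then have "v = 0" using that by simp
      moreover have "0 \<in> zonotope vs" using vs(2) l by (auto simp: subset_iff)
      ultimately show ?thesis using True by (force simp: Z_def zonotope_scale)
    next
      case False
      have "norm ((1 / (l * a)) *\<^sub>R v) \<le> 1 / l"
        using that False l by (simp add: field_simps)
      then have "(1 / (l * a)) *\<^sub>R v \<in> zonotope vs" using vs(2) by auto
      then have "(l * a) *\<^sub>R ((1 / (l * a)) *\<^sub>R v) \<in> Z a" unfolding Z_def zonotope_scale by blast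
      then show ?thesis using False l by simp
    qed
    have Zsub: "norm v \<le> l * a" if "v \<in> Z a" "0 \<le> a" for v a
    proof -
      obtain u where u: "u \<in> zonotope vs" "v = (l * a) *\<^sub>R u" using \<open>v \<in> Z a\<close> by (auto simp: Z_def zonotope_scale)
      then have "norm u \<le> 1" using vs(1) by auto
      then show ?thesis using u that l by (simp add: mult_left_le)
    qed
    have Zlen: "(\<Sum>v\<leftarrow>map ((*\<^sub>R) (l * a)) vs. norm v) \<le> 4 * (l * a)" if "0 \<le> a" for a
    proof -
      have "(\<Sum>v\<leftarrow>map ((*\<^sub>R) (l * a)) vs. norm v) = (l * a) * (\<Sum>v\<leftarrow>vs. norm v)"
        using that l by (induction vs) (auto simp: distrib_left)
      also have "\<dots> \<le> (l * a) * 4" using vs(3) that l by (intro mult_left_mono) auto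
      finally show ?thesis by simp
    qed
    have cZ: "compact (K + Z a)" for a unfolding Z_def by (intro compact_set_plus K compact_zonotope)
    have cZ2: "compact (K + Z s + Z t)" unfolding Z_def by (intro compact_set_plus K compact_zonotope)
    have "closed_nbhd (s + t) K \<subseteq> K + Z s + Z t"
    proof
      fix x assume "x \<in> closed_nbhd (s + t) K"
      then have "x \<in> closed_nbhd t (closed_nbhd s K)" using closed_nbhd_add[OF K(1,3), of t s] st by (auto simp: add.commute)
      moreover have "compact (closed_nbhd s K)" "closed_nbhd s K \<noteq> {}"
        using compact_closed_nbhd subset_closed_nbhd[of s K] K st by auto
      ultimately obtain y k where y: "dist x y \<le> t" "dist y k \<le> s" "k \<in> K"
        using closed_nbhd_iff K(1,3) by metis
      then have "x - y \<in> Z t" "y - k \<in> Z s" using Zsup st by (auto simp: dist_norm)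
      then have "k + (y - k) + (x - y) \<in> K + Z s + Z t" using y by blast
      then show "x \<in> K + Z s + Z t" by simp
    qed
    then have 1: "measure lebesgue (closed_nbhd (s + t) K) \<le> measure lebesgue (K + Z s + Z t)"
      by (rule measure_mono_fmeasurable) (use lm cZ2 in \<open>auto intro: lmeasurable_compact fmeasurableD\<close>)
    have 2: "measure lebesgue (K + Z a) \<le> measure lebesgue (closed_nbhd (l * a) K)" if "0 \<le> a" for a
    proof (rule measure_mono_fmeasurable)
      show "K + Z a \<subseteq> closed_nbhd (l * a) K"
      proof
        fix x assume "x \<in> K + Z a"
        then obtain k v where "k \<in> K" "v \<in> Z a" "x = k + v" by (auto simp: set_plus_def)
        then show "x \<in> closed_nbhd (l * a) K"
          using Zsub[of v a] that closed_nbhd_iff[OF K(1,3)] by (auto simp: dist_norm intro!: bexI[of _ k])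
      qed
    qed (use lm cZ in \<open>auto intro: lmeasurable_compact fmeasurableD\<close>)
    have "mixed_area K (Z s) (Z t) \<le> (\<Sum>v\<leftarrow>map ((*\<^sub>R) (l * s)) vs. norm v) * (\<Sum>v\<leftarrow>map ((*\<^sub>R) (l * t)) vs. norm v)"
      unfolding Z_def by (rule mixed_area_zonotopes[OF K(1,2)])
    also have "\<dots> \<le> (4 * (l * s)) * (4 * (l * t))"
      using st l by (intro mult_mono Zlen sum_list_nonneg) auto
    finally have "mixed_area K (Z s) (Z t) \<le> 16 * (l * s) * (l * t)" by simp
    then show ?thesis using 1 2[of s] 2[of t] st unfolding mixed_area_def by linarith
  qed
  show ?thesis
  proof (rule field_le_epsilon)
    fix e :: real assume "e > 0"
    then have e: "e / 3 > 0" by simp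
    obtain d1 where d1: "d1 > 0" "measure lebesgue (closed_nbhd (s + d1) K) < measure lebesgue (closed_nbhd s K) + e / 3"
      using measure_closed_nbhd_right_continuous[OF K(1,3) st(1) e] by blast
    obtain d2 where d2: "d2 > 0" "measure lebesgue (closed_nbhd (t + d2) K) < measure lebesgue (closed_nbhd t K) + e / 3"
      using measure_closed_nbhd_right_continuous[OF K(1,3) st(2) e] by blast
    have "((\<lambda>l. 16 * (l * s) * (l * t)) \<longlongrightarrow> 16 * (1 * s) * (1 * t)) (at_right 1)"
      and "((\<lambda>l. l * s) \<longlongrightarrow> 1 * s) (at_right 1)" "((\<lambda>l. l * t) \<longlongrightarrow> 1 * t) (at_right 1)"
      by (intro tendsto_intros)+
    then have "eventually (\<lambda>l. 16 * (l * s) * (l * t) < 16 * s * t + e / 3) (at_right 1)"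
      "eventually (\<lambda>l. l * s < s + d1) (at_right 1)" "eventually (\<lambda>l. l * t < t + d2) (at_right 1)"
      using e d1 d2 by (auto elim!: order_tendstoD)
    moreover have "eventually (\<lambda>l::real. l > 1) (at_right 1)" by (rule eventually_at_right_less)
    ultimately have "eventually (\<lambda>l. 16 * (l * s) * (l * t) < 16 * s * t + e / 3 \<and> l * s < s + d1 \<and> l * t < t + d2 \<and> l > 1) (at_right 1)"
      by eventually_elim simp
    then obtain l where l: "16 * (l * s) * (l * t) < 16 * s * t + e / 3" "l * s < s + d1" "l * t < t + d2" "l > 1"
      using eventually_happens'[OF trivial_limit_at_right_real] by blast
    have "measure lebesgue (closed_nbhd (l * s) K) \<le> measure lebesgue (closed_nbhd (s + d1) K)"
      "measure lebesgue (closed_nbhd (l * t) K) \<le> measure lebesgue (closed_nbhd (t + d2) K)"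
      using l lm by (auto intro!: measure_mono_fmeasurable closed_nbhd_mono)
    then show "measure lebesgue (closed_nbhd (s + t) K) + measure lebesgue K
      \<le> measure lebesgue (closed_nbhd s K) + measure lebesgue (closed_nbhd t K) + 16 * s * t + e"
      using approx[OF l(4)] l d1 d2 by linarith
  qed
qed

section \<open>Almost subadditive functions and existence of the content\<close>

lemma almost_subadditive_quotient_le:
  fixes W :: "real \<Rightarrow> real"
  assumes mono: "\<And>s t. 0 \<le> s \<Longrightarrow> s \<le> t \<Longrightarrow> W s \<le> W t" and W0: "W 0 = 0" and C: "0 \<le> C"
    and sub: "\<And>s t. 0 \<le> s \<Longrightarrow> 0 \<le> t \<Longrightarrow> W (s + t) \<le> W s + W t + C * s * t"
    and st: "0 < s" "0 < t"
  shows "W t / t \<le> (1 + s / t) * (W s / s) + C * (t + s)\<^sup>2 / t"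
proof -
  \<comment> \<open>The errors add up to C * s^2 * n * (n - 1) / 2; the cruder square of the total
    length already satisfies the recursion.\<close>
  have mult: "W (real n * s) \<le> real n * W s + C * (real n * s)\<^sup>2" for n
  proof (induction n)
    case (Suc n)
    have "W (real (Suc n) * s) = W (real n * s + s)" by (simp add: algebra_simps)
    also have "\<dots> \<le> W (real n * s) + W s + C * (real n * s) * s" using st by (intro sub) auto
    also have "\<dots> \<le> real n * W s + C * (real n * s)\<^sup>2 + W s + C * (real n * s) * s" using Suc.IH by simp
    also have "\<dots> \<le> real (Suc n) * W s + C * (real (Suc n) * s)\<^sup>2"
    proof -
      have "C * (real (Suc n) * s)\<^sup>2 - C * (real n * s)\<^sup>2 - C * (real n * s) * s = C * ((real n + 1) * s\<^sup>2)"
        by (simp add: power2_eq_square algebra_simps)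
      also have "\<dots> \<ge> 0" using C by simp
      finally show ?thesis by (simp add: algebra_simps)
    qed
    finally show ?case .
  qed (simp add: W0)
  \<comment> \<open>Rounding up lets n steps cover \<open>t\<close> by monotonicity, while their
    total length exceeds \<open>t\<close> by at most one step.\<close>
  define n where "n = nat \<lceil>t / s\<rceil>"
  have "real n = real_of_int \<lceil>t / s\<rceil>" using st by (simp add: n_def)
  then have "t / s \<le> real n" "real n \<le> t / s + 1" by linarith+
  then have n: "t \<le> real n * s" "real n * s \<le> t + s" using st by (simp_all add: field_simps)
  have Ws: "0 \<le> W s" using mono[of 0 s] W0 st by simp
  have "W t \<le> W (real n * s)" using n st by (intro mono) auto
  also have "\<dots> \<le> real n * W s + C * (real n * s)\<^sup>2" by (rule mult)
  also have "\<dots> \<le> (t / s + 1) * W s + C * (t + s)\<^sup>2"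
    using n st C Ws \<open>real n \<le> t / s + 1\<close> by (intro add_mono mult_right_mono mult_left_mono power_mono) auto
  finally have "W t / t \<le> ((t / s + 1) * W s + C * (t + s)\<^sup>2) / t" using st by (intro divide_right_mono) auto
  also have "\<dots> = (1 + s / t) * (W s / s) + C * (t + s)\<^sup>2 / t" using st by (simp add: field_simps)
  finally show ?thesis .
qed

text \<open>Letting \<open>s\<close> tend to 0 bounds the quotient at \<open>t\<close> by the lower
  limit plus \<open>C * t\<close>; letting \<open>t\<close> tend to 0 then squeezes the upper limit
  onto the lower one. The values are in \<open>ennreal\<close> because the limit may be
  infinite.\<close>

lemma tendsto_almost_subadditive_quotient:
  fixes W :: "real \<Rightarrow> real"
  assumes mono: "\<And>s t. 0 \<le> s \<Longrightarrow> s \<le> t \<Longrightarrow> W s \<le> W t" and W0: "W 0 = 0" and C: "0 \<le> C"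
    and sub: "\<And>s t. 0 \<le> s \<Longrightarrow> 0 \<le> t \<Longrightarrow> W (s + t) \<le> W s + W t + C * s * t"
  obtains l where "((\<lambda>t. ennreal (W t / t)) \<longlongrightarrow> l) (at_right 0)"
    "\<And>t. 0 < t \<Longrightarrow> ennreal (W t / t) \<le> l + ennreal (C * t)"
proof -
  define f where "f = (\<lambda>t. ennreal (W t / t))"
  define l where "l = Liminf (at_right 0) f"
  have nt: "\<not> trivial_limit (at_right (0::real))" by simp
  have bound: "f t \<le> l + ennreal (C * t)" if t: "0 < t" for t
  proof (cases "l = top")
    case False
    then obtain lr where lr: "l = ennreal lr" "0 \<le> lr" by (metis ennreal_cases infinity_ennreal_def)
    have "W t / t \<le> lr + C * t"
    proof (rule field_le_epsilon)
      fix e :: real assume e: "e > 0"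
      show "W t / t \<le> lr + C * t + e"
      proof (rule ccontr)
        assume n: "\<not> W t / t \<le> lr + C * t + e"
        \<comment> \<open>If the bound failed at \<open>t\<close>, every sufficiently small
          \<open>s\<close> would have quotient at least \<open>lr + e / 2\<close>, which lifts the
          lower limit above \<open>lr\<close>.\<close>
        have "((\<lambda>s. (1 + s / t) * (lr + e / 2) + C * (t + s)\<^sup>2 / t) \<longlongrightarrow> (1 + 0 / t) * (lr + e / 2) + C * (t + 0)\<^sup>2 / t) (at_right 0)"
          using t by (intro tendsto_intros) auto
        moreover have "(1 + 0 / t) * (lr + e / 2) + C * (t + 0)\<^sup>2 / t < W t / t"
          using n t e by (simp add: power2_eq_square)
        ultimately have "eventually (\<lambda>s. (1 + s / t) * (lr + e / 2) + C * (t + s)\<^sup>2 / t < W t / t) (at_right 0)"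
          by (rule order_tendstoD)
        moreover have "eventually (\<lambda>s::real. s > 0) (at_right 0)" by (rule eventually_at_right_less)
        ultimately have "eventually (\<lambda>s. ennreal (lr + e / 2) \<le> f s) (at_right 0)"
        proof eventually_elim
          case (elim s)
          have "W t / t \<le> (1 + s / t) * (W s / s) + C * (t + s)\<^sup>2 / t"
            using almost_subadditive_quotient_le[OF mono W0 C sub, of s t] elim t by blast
          then have "(1 + s / t) * (lr + e / 2) < (1 + s / t) * (W s / s)" using elim by linarith
          moreover have "1 + s / t > 0" using elim t by (simp add: add_pos_pos)
          ultimately have "lr + e / 2 < W s / s" by (simp only: mult_less_cancel_left_pos)
          then show ?case unfolding f_def by (intro ennreal_leI) simp
        qed
        then have "ennreal (lr + e / 2) \<le> l" unfolding l_def by (rule Liminf_bounded)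
        then show False using lr e by (simp add: ennreal_le_iff)
      qed
    qed
    then have "f t \<le> ennreal (lr + C * t)" unfolding f_def by (rule ennreal_leI)
    then show ?thesis using lr C t by (simp add: ennreal_plus)
  qed simp
  have "((\<lambda>t. l + ennreal (C * t)) \<longlongrightarrow> l + ennreal (C * 0)) (at_right 0)"
    by (intro tendsto_add tendsto_const tendsto_ennrealI tendsto_mult tendsto_ident_at)
  then have "Limsup (at_right 0) (\<lambda>t. l + ennreal (C * t)) = l"
    using lim_imp_Limsup[OF nt] by fastforce
  moreover have "Limsup (at_right 0) f \<le> Limsup (at_right 0) (\<lambda>t. l + ennreal (C * t))"
    using bound by (intro Limsup_mono eventually_at_right_less[THEN eventually_mono]) auto
  ultimately have "Limsup (at_right 0) f = l"
    using Liminf_le_Limsup[OF nt, of f] by (simp add: l_def)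
  then have "(f \<longlongrightarrow> l) (at_right 0)"
    unfolding tendsto_iff_Liminf_eq_Limsup[OF nt] by (simp add: l_def)
  then show ?thesis using that bound by (simp add: f_def)
qed

lemma minkowski_quotient_eq:
  assumes K: "compact K" "K \<noteq> {}" and t: "0 < t"
  shows "emeasure lebesgue (closed_nbhd t K - K) / ennreal t
    = ennreal ((measure lebesgue (closed_nbhd t K) - measure lebesgue K) / t)"
proof -
  have m: "closed_nbhd t K \<in> lmeasurable" "K \<in> lmeasurable" "K \<subseteq> closed_nbhd t K"
    using lmeasurable_closed_nbhd[OF K] lmeasurable_compact[OF K(1)] subset_closed_nbhd t by auto
  then have "emeasure lebesgue (closed_nbhd t K - K) = ennreal (measure lebesgue (closed_nbhd t K - K))"
    by (intro emeasure_eq_measure2) (auto intro: fmeasurable_Diff)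
  also have "\<dots> = ennreal (measure lebesgue (closed_nbhd t K) - measure lebesgue K)"
    using m by (simp add: measurable_measure_Diff)
  finally show ?thesis
    using t m by (simp add: divide_ennreal measure_mono_fmeasurable)
qed

text \<open>Existence of the limit is what makes \<open>Lim\<close> in the definition of the content
  meaningful. The error \<open>16 * t\<close> is the same for all continua.\<close>

lemma outer_minkowski_content_continuum:
  assumes K: "continuum K"
  shows outer_minkowski_content_tendsto:
      "((\<lambda>t. ennreal ((measure lebesgue (closed_nbhd t K) - measure lebesgue K) / t))
         \<longlongrightarrow> outer_minkowski_content K) (at_right 0)"
    and outer_minkowski_content_lower_bound:
      "0 < t \<Longrightarrow> ennreal ((measure lebesgue (closed_nbhd t K) - measure lebesgue K) / t)
         \<le> outer_minkowski_content K + ennreal (16 * t)"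
proof -
  have cK: "compact K" "K \<noteq> {}" using K by (auto simp: continuum_def)
  define W where "W t = measure lebesgue (closed_nbhd t K) - measure lebesgue K" for t
  have mono: "W s \<le> W t" if "0 \<le> s" "s \<le> t" for s t
    unfolding W_def using lmeasurable_closed_nbhd[OF cK] that
    by (auto intro!: measure_mono_fmeasurable closed_nbhd_mono)
  have W0: "W 0 = 0" by (simp add: W_def closed_nbhd_0[OF cK])
  have sub: "W (s + t) \<le> W s + W t + 16 * s * t" if "0 \<le> s" "0 \<le> t" for s t
    unfolding W_def using measure_closed_nbhd_subadditive[OF K that] by simp
  obtain l where l: "((\<lambda>t. ennreal (W t / t)) \<longlongrightarrow> l) (at_right 0)"
    "\<And>t. 0 < t \<Longrightarrow> ennreal (W t / t) \<le> l + ennreal (16 * t)"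
    by (rule tendsto_almost_subadditive_quotient[OF mono W0 _ sub]) auto
  have "((\<lambda>t. emeasure lebesgue (closed_nbhd t K - K) / ennreal t) \<longlongrightarrow> l) (at_right 0)"
    using l(1) by (rule tendsto_cong[THEN iffD1, rotated])
      (auto simp: minkowski_quotient_eq[OF cK] W_def intro!: eventually_at_right_less[THEN eventually_mono])
  then have "outer_minkowski_content K = l"
    unfolding outer_minkowski_content_def by (intro tendsto_Lim) auto
  then show "((\<lambda>t. ennreal ((measure lebesgue (closed_nbhd t K) - measure lebesgue K) / t))
         \<longlongrightarrow> outer_minkowski_content K) (at_right 0)"
    "0 < t \<Longrightarrow> ennreal ((measure lebesgue (closed_nbhd t K) - measure lebesgue K) / t)
         \<le> outer_minkowski_content K + ennreal (16 * t)"
    using l by (auto simp: W_def)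
qed

text \<open>Trades the constraint on a limit for inequalities between areas at each positive radius.
  These survive Hausdorff convergence; the quadratic term vanishes again in the quotient as
  \<open>t\<close> tends to 0.\<close>

lemma outer_minkowski_content_le_iff:
  assumes K: "continuum K" and L: "0 \<le> L"
  shows "outer_minkowski_content K \<le> ennreal L
    \<longleftrightarrow> (\<forall>t>0. measure lebesgue (closed_nbhd t K) \<le> measure lebesgue K + L * t + 16 * t\<^sup>2)"
proof
  assume le: "outer_minkowski_content K \<le> ennreal L"
  show "\<forall>t>0. measure lebesgue (closed_nbhd t K) \<le> measure lebesgue K + L * t + 16 * t\<^sup>2"
  proof (intro allI impI)
    fix t :: real assume t: "t > 0"
    have "ennreal ((measure lebesgue (closed_nbhd t K) - measure lebesgue K) / t) \<le> ennreal L + ennreal (16 * t)"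
      using outer_minkowski_content_lower_bound[OF K t] le add_right_mono order_trans by blast
    also have "\<dots> = ennreal (L + 16 * t)" using L t by (simp add: ennreal_plus)
    finally have "(measure lebesgue (closed_nbhd t K) - measure lebesgue K) / t \<le> L + 16 * t"
      using L t by (subst (asm) ennreal_le_iff) auto
    then show "measure lebesgue (closed_nbhd t K) \<le> measure lebesgue K + L * t + 16 * t\<^sup>2"
      using t by (simp add: field_simps power2_eq_square)
  qed
next
  assume b: "\<forall>t>0. measure lebesgue (closed_nbhd t K) \<le> measure lebesgue K + L * t + 16 * t\<^sup>2"
  have "((\<lambda>t. ennreal (L + 16 * t)) \<longlongrightarrow> ennreal (L + 16 * 0)) (at_right 0)"
    by (intro tendsto_ennrealI tendsto_add tendsto_mult tendsto_const tendsto_ident_at)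
  moreover have "eventually (\<lambda>t. ennreal ((measure lebesgue (closed_nbhd t K) - measure lebesgue K) / t) \<le> ennreal (L + 16 * t)) (at_right 0)"
    using eventually_at_right_less[of 0]
  proof eventually_elim
    case (elim t)
    then have "measure lebesgue (closed_nbhd t K) - measure lebesgue K \<le> (L + 16 * t) * t"
      using b by (auto simp: algebra_simps power2_eq_square)
    then show ?case using elim by (intro ennreal_leI) (simp add: divide_le_eq)
  qed
  ultimately have "outer_minkowski_content K \<le> ennreal (L + 16 * 0)"
    using outer_minkowski_content_tendsto[OF K] by (intro tendsto_le[of "at_right 0"]) auto
  then show "outer_minkowski_content K \<le> ennreal L" by simp
qed

lemma continuum_singleton: "continuum {x}"
  by (simp add: continuum_def)

text \<open>Singletons ensure that competitors exist. The area pi * t^2 of a disc is absorbed by the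
  quadratic slack, as pi < 4.\<close>

lemma outer_minkowski_content_singleton_le:
  assumes "0 \<le> L"
  shows "outer_minkowski_content {x} \<le> ennreal L"
proof -
  have "measure lebesgue (closed_nbhd t {x}) \<le> measure lebesgue {x} + L * t + 16 * t\<^sup>2" if "t > 0" for t
  proof -
    have "closed_nbhd t {x} = cball x t" by (auto simp: closed_nbhd_def dist_commute)
    then have "measure lebesgue (closed_nbhd t {x}) = t\<^sup>2 * pi"
      using that by (simp add: measure_completion content_cball unit_ball_vol_2 mult.commute)
    also have "\<dots> \<le> t\<^sup>2 * 16" using pi_less_4 by (intro mult_left_mono) auto
    finally show ?thesis using assms that by (simp add: add_increasing mult.commute)
  qed
  then show ?thesis using outer_minkowski_content_le_iff[OF continuum_singleton assms] by blast
qed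

section \<open>Compactness of continua and semicontinuity of the content\<close>

text \<open>Distance functions are 1-Lipschitz and on \<open>S\<close> bounded by its diameter, so
  Arzela-Ascoli gives a uniform limit of them. The two eventual statements express Hausdorff
  convergence in the one-sided forms in which it is applied.\<close>

lemma continua_convergent_subsequence:
  fixes K :: "nat \<Rightarrow> (real^2) set"
  assumes S: "compact S" and K: "\<And>n. continuum (K n)" "\<And>n. K n \<subseteq> S"
  obtains r K' where "strict_mono (r :: nat \<Rightarrow> nat)" "continuum K'" "K' \<subseteq> S"
    "\<And>U. open U \<Longrightarrow> K' \<subseteq> U \<Longrightarrow> eventually (\<lambda>n. K (r n) \<subseteq> U) sequentially"
    "\<And>e. 0 < e \<Longrightarrow> eventually (\<lambda>n. K' \<subseteq> closed_nbhd e (K (r n))) sequentially"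
proof -
  have Kn: "compact (K n)" "connected (K n)" "K n \<noteq> {}" for n using K(1)[of n] by (auto simp: continuum_def)
  have M: "norm (infdist x (K n)) \<le> diameter S" if "x \<in> S" for x n
  proof -
    obtain k where k: "k \<in> K n" using Kn(3)[of n] by blast
    then have "infdist x (K n) \<le> dist x k" by (rule infdist_le)
    also have "\<dots> \<le> diameter S"
      using diameter_bounded_bound[OF compact_imp_bounded[OF S] that] k K(2) by blast
    finally show ?thesis by (simp add: infdist_nonneg)
  qed
  have eq: "\<exists>d>0. \<forall>n y. y \<in> S \<and> norm (x - y) < d \<longrightarrow> norm (infdist x (K n) - infdist y (K n)) < e"
    if "0 < e" for x e
    using that infdist_triangle_abs[of x _ ] by (intro exI[of _ e]) (auto simp: dist_norm intro: le_less_trans)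
  obtain g r where g: "continuous_on S g" and r: "strict_mono (r :: nat \<Rightarrow> nat)"
    and lim: "\<And>e. 0 < e \<Longrightarrow> \<exists>N. \<forall>n x. n \<ge> N \<and> x \<in> S \<longrightarrow> norm (infdist x (K (r n)) - g x) < e"
    using Arzela_Ascoli[OF S M eq] by blast
  have g0: "0 \<le> g x" if xS: "x \<in> S" for x
  proof (rule ccontr)
    assume "\<not> 0 \<le> g x"
    then have "0 < - g x" by simp
    then obtain N where "\<And>n. n \<ge> N \<Longrightarrow> norm (infdist x (K (r n)) - g x) < - g x"
      using lim[OF \<open>0 < - g x\<close>] xS by blast
    from this[of N] show False using infdist_nonneg[of x "K (r N)"] by auto
  qed
  \<comment> \<open>A set is the zero set of its distance function when closed, so the zero set of
    the limit is the candidate; no separate proof that \<open>g\<close> is its distance function is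
    made.\<close>
  define K' where "K' = {x \<in> S. g x = 0}"
  have lower: "eventually (\<lambda>n. K' \<subseteq> closed_nbhd e (K (r n))) sequentially" if e: "0 < e" for e
  proof -
    obtain N where N: "\<And>n x. n \<ge> N \<Longrightarrow> x \<in> S \<Longrightarrow> norm (infdist x (K (r n)) - g x) < e"
      using lim[OF e] by blast
    have "K' \<subseteq> closed_nbhd e (K (r n))" if "n \<ge> N" for n
    proof
      fix x assume "x \<in> K'"
      then show "x \<in> closed_nbhd e (K (r n))"
        using N[OF that, of x] by (auto simp: K'_def closed_nbhd_def)
    qed
    then show ?thesis unfolding eventually_sequentially by blast
  qed
  have upper: "eventually (\<lambda>n. K (r n) \<subseteq> U) sequentially" if U: "open U" "K' \<subseteq> U" for U
  proof (cases "S - U = {}")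
    case True
    then have "K (r n) \<subseteq> U" for n using K(2)[of "r n"] by blast
    then show ?thesis by simp
  next
    case False
    \<comment> \<open>On this compact set \<open>g\<close> has a positive minimum, so the uniformly
      close distance functions cannot vanish there.\<close>
    have c: "compact (S - U)" using S U by (simp add: compact_diff)
    obtain m where m: "m \<in> S - U" "\<And>y. y \<in> S - U \<Longrightarrow> g m \<le> g y"
      using continuous_attains_inf[OF c False continuous_on_subset[OF g]] by blast
    have "g m \<noteq> 0" using m(1) U(2) unfolding K'_def by blast
    then have pos: "0 < g m" using g0[of m] m(1) by simp
    obtain N where N: "\<And>n x. n \<ge> N \<Longrightarrow> x \<in> S \<Longrightarrow> norm (infdist x (K (r n)) - g x) < g m"
      using lim[OF pos] by blast
    have "K (r n) \<subseteq> U" if "n \<ge> N" for n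
    proof
      fix x assume x: "x \<in> K (r n)"
      then have "x \<in> S" using K(2) by blast
      show "x \<in> U"
      proof (rule ccontr)
        assume "x \<notin> U"
        then have "g m \<le> g x" using m(2) \<open>x \<in> S\<close> by blast
        moreover have "infdist x (K (r n)) = 0" using x by simp
        ultimately show False using N[OF that \<open>x \<in> S\<close>] by simp
      qed
    qed
    then show ?thesis unfolding eventually_sequentially by blast
  qed
  have near: "eventually (\<lambda>n. K (r n) \<inter> V \<noteq> {}) sequentially" if V: "open V" "y \<in> V" "y \<in> K'" for V y
  proof -
    obtain d where d: "d > 0" "cball y d \<subseteq> V" using V open_contains_cball by blast
    show ?thesis using lower[OF d(1)]
    proof eventually_elim
      case (elim n)
      then obtain k where "k \<in> K (r n)" "dist y k \<le> d" using V closed_nbhd_iff[OF Kn(1,3)] by blast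
      then show ?case using d by auto
    qed
  qed
  have clK: "closed K'"
    unfolding K'_def using continuous_closed_preimage_constant[OF g compact_imp_closed[OF S], of 0] by simp
  have "bounded K'" using bounded_subset[OF compact_imp_bounded[OF S]] by (auto simp: K'_def)
  with clK have cK: "compact K'" by (simp add: compact_eq_bounded_closed)
  have ne: "K' \<noteq> {}"
  proof
    assume "K' = {}"
    then obtain n where "K (r n) \<subseteq> {}" using upper[of "{}"] eventually_happens'[OF sequentially_bot] by blast
    then show False using Kn by blast
  qed
  have "connected K'"
  proof (rule ccontr)
    assume "\<not> connected K'"
    then obtain A B where AB: "closed A" "closed B" "A \<noteq> {}" "B \<noteq> {}" "A \<union> B = K'" "A \<inter> B = {}"
      using connected_closed_set[OF clK] by blast
    \<comment> \<open>Disjoint open sets around the two pieces would eventually cover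
      \<open>K (r n)\<close> and both meet it, contradicting its connectedness.\<close>
    then obtain U V where UV: "open U" "open V" "A \<subseteq> U" "B \<subseteq> V" "U \<inter> V = {}"
      using separation_normal by metis
    obtain a b where ab: "a \<in> A" "b \<in> B" using AB by blast
    have "eventually (\<lambda>n. K (r n) \<subseteq> U \<union> V) sequentially" using UV AB by (intro upper) auto
    moreover have "eventually (\<lambda>n. K (r n) \<inter> U \<noteq> {}) sequentially" using UV AB ab by (intro near[of U a]) auto
    moreover have "eventually (\<lambda>n. K (r n) \<inter> V \<noteq> {}) sequentially" using UV AB ab by (intro near[of V b]) auto
    ultimately have "eventually (\<lambda>n. K (r n) \<subseteq> U \<union> V \<and> K (r n) \<inter> U \<noteq> {} \<and> K (r n) \<inter> V \<noteq> {}) sequentially"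
      by eventually_elim simp
    then obtain n where "K (r n) \<subseteq> U \<union> V" "K (r n) \<inter> U \<noteq> {}" "K (r n) \<inter> V \<noteq> {}"
      using eventually_happens'[OF sequentially_bot] by blast
    then show False using Kn(2)[of "r n"] UV unfolding connected_def by blast
  qed
  then have "continuum K'" using cK ne by (simp add: continuum_def)
  then show ?thesis using that r upper lower by (auto simp: K'_def)
qed

text \<open>Each one-sided form of convergence has its place: \<open>lower\<close> puts the
  \<open>t\<close>-neighbourhood of \<open>K'\<close> into the \<open>(t + e)\<close>-neighbourhood
  of \<open>K n\<close>, and \<open>upper\<close> bounds the area of \<open>K n\<close> by that of
  an \<open>e\<close>-neighbourhood of \<open>K'\<close>. Outer regularity then removes
  \<open>e\<close>.\<close>

lemma outer_minkowski_content_lower_semicontinuous: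
  assumes K: "\<And>n. continuum (K n)" and K': "continuum K'" and L: "0 \<le> L"
    and SM: "\<And>n. outer_minkowski_content (K n) \<le> ennreal L"
    and upper: "\<And>U. open U \<Longrightarrow> K' \<subseteq> U \<Longrightarrow> eventually (\<lambda>n. K n \<subseteq> U) sequentially"
    and lower: "\<And>e. 0 < e \<Longrightarrow> eventually (\<lambda>n. K' \<subseteq> closed_nbhd e (K n)) sequentially"
  shows "outer_minkowski_content K' \<le> ennreal L"
proof -
  have cK': "compact K'" "K' \<noteq> {}" using K' by (auto simp: continuum_def)
  have cK: "compact (K n)" "K n \<noteq> {}" for n using K[of n] by (auto simp: continuum_def)
  have step: "measure lebesgue (closed_nbhd t K') \<le> measure lebesgue (closed_nbhd e K') + L * (t + e) + 16 * (t + e)\<^sup>2"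
    if t: "0 < t" and e: "0 < e" for t e
  proof -
    have "open {x. infdist x K' < e}" by (intro open_Collect_less continuous_intros)
    moreover have "K' \<subseteq> {x. infdist x K' < e}" using e by auto
    ultimately have "eventually (\<lambda>n. K n \<subseteq> {x. infdist x K' < e}) sequentially" by (rule upper)
    then have "eventually (\<lambda>n. K n \<subseteq> {x. infdist x K' < e} \<and> K' \<subseteq> closed_nbhd e (K n)) sequentially"
      using lower[OF e] by eventually_elim simp
    then obtain n where n: "K n \<subseteq> {x. infdist x K' < e}" "K' \<subseteq> closed_nbhd e (K n)"
      using eventually_happens'[OF sequentially_bot] by blast
    have "closed_nbhd t K' \<subseteq> closed_nbhd (t + e) (K n)"
    proof
      fix x assume "x \<in> closed_nbhd t K'"
      then obtain y where y: "y \<in> K'" "dist x y \<le> t" using closed_nbhd_iff[OF cK'] by blast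
      then obtain k where "k \<in> K n" "dist y k \<le> e" using n closed_nbhd_iff[OF cK] by blast
      then show "x \<in> closed_nbhd (t + e) (K n)"
        using y dist_triangle[of x k y] closed_nbhd_iff[OF cK] by force
    qed
    then have "measure lebesgue (closed_nbhd t K') \<le> measure lebesgue (closed_nbhd (t + e) (K n))"
      using lmeasurable_closed_nbhd[OF cK'] lmeasurable_closed_nbhd[OF cK] by (intro measure_mono_fmeasurable) auto
    also have "\<dots> \<le> measure lebesgue (K n) + L * (t + e) + 16 * (t + e)\<^sup>2"
      using outer_minkowski_content_le_iff[OF K L] SM t e by (simp add: add_pos_pos)
    also have "measure lebesgue (K n) \<le> measure lebesgue (closed_nbhd e K')"
      using n(1) lmeasurable_closed_nbhd[OF cK'] lmeasurable_compact[OF cK(1)]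
      by (intro measure_mono_fmeasurable) (auto simp: closed_nbhd_def)
    finally show ?thesis by simp
  qed
  have "measure lebesgue (closed_nbhd t K') \<le> measure lebesgue K' + L * t + 16 * t\<^sup>2" if t: "0 < t" for t
  proof (rule field_le_epsilon)
    fix e :: real assume "e > 0"
    then have e: "e / 2 > 0" by simp
    obtain d where d: "d > 0" "measure lebesgue (closed_nbhd d K') < measure lebesgue K' + e / 2"
      using measure_closed_nbhd_less[OF cK' e] by blast
    have "((\<lambda>s. L * (t + s) + 16 * (t + s)\<^sup>2) \<longlongrightarrow> L * (t + 0) + 16 * (t + 0)\<^sup>2) (at_right 0)"
      by (intro tendsto_intros)
    then have "eventually (\<lambda>s. L * (t + s) + 16 * (t + s)\<^sup>2 < L * t + 16 * t\<^sup>2 + e / 2) (at_right 0)"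
      using e by (auto elim!: order_tendstoD)
    moreover have "eventually (\<lambda>s. s \<in> {0<..<d}) (at_right 0)" using d(1) by (rule eventually_at_right_real)
    ultimately have "eventually (\<lambda>s. L * (t + s) + 16 * (t + s)\<^sup>2 < L * t + 16 * t\<^sup>2 + e / 2 \<and> 0 < s \<and> s < d) (at_right 0)"
      by eventually_elim simp
    then obtain s where s: "L * (t + s) + 16 * (t + s)\<^sup>2 < L * t + 16 * t\<^sup>2 + e / 2" "0 < s" "s < d"
      using eventually_happens'[OF trivial_limit_at_right_real] by blast
    have "measure lebesgue (closed_nbhd s K') \<le> measure lebesgue (closed_nbhd d K')"
      using s lmeasurable_closed_nbhd[OF cK'] by (auto intro!: measure_mono_fmeasurable closed_nbhd_mono)
    then show "measure lebesgue (closed_nbhd t K') \<le> measure lebesgue K' + L * t + 16 * t\<^sup>2 + e"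
      using step[OF t s(2)] s d by linarith
  qed
  then show ?thesis using outer_minkowski_content_le_iff[OF K' L] by blast
qed

section \<open>Upper semicontinuity of the first eigenvalue\<close>

text \<open>Translation invariance makes the integral of every difference quotient vanish, and
  dominated convergence passes this to the derivative. Applied to a product of test functions it is
  integration by parts.\<close>

lemma integral_directional_derivative_eq_0:
  fixes F :: "'a::euclidean_space \<Rightarrow> real"
  assumes diff: "\<And>x. (F has_derivative F' x) (at x)"
    and cont: "continuous_on UNIV (\<lambda>x. F' x v)"
    and S: "compact S" and supp: "\<And>x. x \<notin> S \<Longrightarrow> F x = 0"
  shows "integral\<^sup>L lborel (\<lambda>x. F' x v) = 0"
proof -
  define q where "q n x = (F (x + (1 / real (Suc n)) *\<^sub>R v) - F x) * real (Suc n)" for n x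
  have contF: "continuous_on UNIV F"
    by (intro continuous_at_imp_continuous_on ballI has_derivative_continuous[OF diff])
  have line: "((\<lambda>h. F (x + h *\<^sub>R v)) has_real_derivative F' (x + h *\<^sub>R v) v) (at h)" for x h
  proof -
    have "((\<lambda>h. x + h *\<^sub>R v) has_derivative (\<lambda>h. h *\<^sub>R v)) (at h)"
      by (auto intro!: derivative_eq_intros)
    from diff_chain_at[OF this diff] have "((\<lambda>h. F (x + h *\<^sub>R v)) has_derivative (\<lambda>k. F' (x + h *\<^sub>R v) (k *\<^sub>R v))) (at h)"
      by (simp add: o_def)
    moreover have "(\<lambda>k. F' (x + h *\<^sub>R v) (k *\<^sub>R v)) = (*) (F' (x + h *\<^sub>R v) v)"
      using linear_scale[OF has_derivative_linear[OF diff]] by (simp add: fun_eq_iff mult.commute)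
    ultimately show ?thesis unfolding has_field_derivative_def by simp
  qed
  \<comment> \<open>\<open>S'\<close> collects the points from which a step of length factor at most
    1 along \<open>v\<close> can reach \<open>S\<close>, so all difference quotients vanish outside
    it. \<open>T\<close> below collects the intermediate points of the mean value theorem, and the
    derivative is bounded there by compactness.\<close>
  define S' where "S' = (\<lambda>(y, s). y - s *\<^sub>R v) ` (S \<times> {0..1::real})"
  have S': "compact S'" unfolding S'_def
    by (intro compact_continuous_image compact_Times S) (auto simp: case_prod_unfold intro!: continuous_intros)
  have mem: "x \<in> S'" if "x + s *\<^sub>R v \<in> S" "0 \<le> s" "s \<le> 1" for x s
    unfolding S'_def using that by (intro image_eqI[of _ _ "(x + s *\<^sub>R v, s)"]) auto
  define T where "T = (\<lambda>(y, s). y + s *\<^sub>R v) ` (S' \<times> {0..1::real})"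
  have T: "compact T" unfolding T_def
    by (intro compact_continuous_image compact_Times S') (auto simp: case_prod_unfold intro!: continuous_intros)
  have "bounded ((\<lambda>x. F' x v) ` T)"
    by (intro compact_imp_bounded compact_continuous_image T continuous_on_subset[OF cont]) auto
  then obtain M where M: "\<And>x. x \<in> T \<Longrightarrow> \<bar>F' x v\<bar> \<le> M" by (auto simp: bounded_iff)
  have small: "0 \<le> 1 / real (Suc n)" "1 / real (Suc n) \<le> 1" for n by auto
  have bound: "norm (q n x) \<le> indicator S' x * M" for n x
  proof (cases "x \<in> S'")
    case True
    have "0 < 1 / real (Suc n)" by simp
    from MVT2[OF this, of "\<lambda>h. F (x + h *\<^sub>R v)" "\<lambda>h. F' (x + h *\<^sub>R v) v"] line
    obtain z where z: "0 < z" "z < 1 / real (Suc n)"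
      "F (x + (1 / real (Suc n)) *\<^sub>R v) - F (x + 0 *\<^sub>R v) = (1 / real (Suc n) - 0) * F' (x + z *\<^sub>R v) v"
      by blast
    then have "q n x = F' (x + z *\<^sub>R v) v" by (simp add: q_def)
    moreover have "z \<le> 1" using z(2) small(2)[of n] by linarith
    then have "x + z *\<^sub>R v \<in> T" unfolding T_def
      using True z(1) by (intro image_eqI[of _ _ "(x, z)"]) auto
    ultimately show ?thesis using M True by simp
  next
    case False
    then have "x \<notin> S" "x + (1 / real (Suc n)) *\<^sub>R v \<notin> S"
      using mem[of x 0] mem[of x "1 / real (Suc n)", OF _ small] by auto
    then show ?thesis using False supp[of x] supp[of "x + (1 / real (Suc n)) *\<^sub>R v"]
      by (simp add: q_def del: of_nat_Suc)
  qed
  have lim: "(\<lambda>n. q n x) \<longlonglongrightarrow> F' x v" for x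
  proof -
    have "((\<lambda>h. (F (x + h *\<^sub>R v) - F x) / h) \<longlongrightarrow> F' x v) (at 0)"
      using line[of x 0] by (simp add: DERIV_def)
    moreover have "filterlim (\<lambda>n. 1 / real (Suc n)) (at 0) sequentially"
      using LIMSEQ_inverse_real_of_nat by (auto simp: filterlim_at inverse_eq_divide)
    ultimately have "(\<lambda>n. (F (x + (1 / real (Suc n)) *\<^sub>R v) - F x) / (1 / real (Suc n))) \<longlonglongrightarrow> F' x v"
      by (rule filterlim_compose)
    then show ?thesis by (simp add: q_def)
  qed
  have meas: "q n \<in> borel_measurable lborel" "(\<lambda>x. F' x v) \<in> borel_measurable lborel" for n
    unfolding q_def using cont contF by (auto intro!: borel_measurable_continuous_onI continuous_intros continuous_on_compose2[OF contF])
  have w: "integrable lborel (\<lambda>x. indicator S' x * M)"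
    using borel_integrable_compact[OF S', of "\<lambda>x. M"] by simp
  have "(\<lambda>n. integral\<^sup>L lborel (q n)) \<longlonglongrightarrow> integral\<^sup>L lborel (\<lambda>x. F' x v)"
    by (rule integral_dominated_convergence[OF meas(2) meas(1) w]) (use lim bound in auto)
  moreover have "integral\<^sup>L lborel (q n) = 0" for n
  proof -
    have int: "integrable lborel F"
    proof -
      have eq: "(\<lambda>x. indicator S x *\<^sub>R F x) = F" using supp by (auto simp: fun_eq_iff indicator_def)
      show ?thesis using borel_integrable_compact[OF S continuous_on_subset[OF contF]] unfolding eq by simp
    qed
    let ?c = "(1 / real (Suc n)) *\<^sub>R v"
    have Fm: "F \<in> borel_measurable borel" using contF by (rule borel_measurable_continuous_onI)
    have "integral\<^sup>L lborel F = integral\<^sup>L (distr lborel borel ((+) ?c)) F" by (simp add: lborel_distr_plus)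
    also have "\<dots> = integral\<^sup>L lborel (\<lambda>x. F (?c + x))" by (rule integral_distr) (auto simp: Fm)
    finally have eq: "integral\<^sup>L lborel (\<lambda>x. F (x + ?c)) = integral\<^sup>L lborel F" by (simp add: add.commute)
    have "integrable (distr lborel borel ((+) ?c)) F" using int by (simp add: lborel_distr_plus)
    then have "integrable lborel (\<lambda>x. F (?c + x))" by (subst (asm) integrable_distr_eq) (auto simp: Fm)
    then have "integrable lborel (\<lambda>x. F (x + ?c))" by (simp add: add.commute)
    then show ?thesis unfolding q_def using int eq by (simp del: of_nat_Suc)
  qed
  ultimately show ?thesis using LIMSEQ_unique[of "\<lambda>n. 0::real" 0] by simp
qed

lemma test_functionsD:
  assumes "\<phi> \<in> test_functions D"
  shows test_function_continuous: "continuous_on UNIV \<phi>"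
    and test_function_has_derivative: "(\<phi> has_derivative frechet_derivative \<phi> (at x)) (at x)"
    and test_function_derivative_continuous: "continuous_on UNIV (\<lambda>x. frechet_derivative \<phi> (at x) v)"
    and test_function_gradient_continuous: "continuous_on UNIV (gradient \<phi>)"
proof -
  have C: "Ck k \<phi>" for k using assms by (auto simp: test_functions_def)
  show "continuous_on UNIV \<phi>" using C[of 0] by simp
  show "(\<phi> has_derivative frechet_derivative \<phi> (at x)) (at x)"
    using C[of 1] by (simp flip: frechet_derivative_works)
  show *: "continuous_on UNIV (\<lambda>x. frechet_derivative \<phi> (at x) v)" for v
    using C[of 1] by simp
  show "continuous_on UNIV (gradient \<phi>)"
    unfolding gradient_def using * by (intro continuous_on_vec_lambda) auto
qed

lemma test_function_support:
  assumes "\<phi> \<in> test_functions D"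
  obtains S where "compact S" "S \<subseteq> D" "\<And>x. x \<notin> S \<Longrightarrow> \<phi> x = 0"
    "\<And>x. x \<notin> S \<Longrightarrow> gradient \<phi> x = 0"
proof -
  define S where "S = closure {x. \<phi> x \<noteq> 0}"
  have S: "compact S" "S \<subseteq> D" using assms by (auto simp: S_def test_functions_def)
  have 0: "\<phi> x = 0" if "x \<notin> S" for x using that closure_subset[of "{x. \<phi> x \<noteq> 0}"] unfolding S_def by blast
  have d: "frechet_derivative \<phi> (at x) = (\<lambda>_. 0)" if "x \<notin> S" for x
  proof -
    have "open (- S)" unfolding S_def by (intro open_Compl closed_closure)
    then have "(\<phi> has_derivative (\<lambda>_. 0)) (at x)"
      by (rule has_derivative_transform_within_open[OF has_derivative_const[of 0]]) (use that 0 in auto)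
    then show ?thesis using frechet_derivative_at by metis
  qed
  then have "gradient \<phi> x = 0" if "x \<notin> S" for x
    using that by (simp add: gradient_def vec_eq_iff)
  with S 0 show ?thesis using that by auto
qed

lemma continuous_compact_support_integrable:
  fixes f :: "real^2 \<Rightarrow> 'b::{banach, second_countable_topology}"
  assumes "continuous_on UNIV f" "compact S" "\<And>x. x \<notin> S \<Longrightarrow> f x = 0" "D \<in> sets lebesgue"
  shows "integrable lborel f" "integrable (lebesgue_on D) f" "f \<in> borel_measurable (lebesgue_on D)"
proof -
  have eq: "(\<lambda>x. indicator S x *\<^sub>R f x) = f" using assms(3) by (auto simp: fun_eq_iff indicator_def)
  show i: "integrable lborel f"
    using borel_integrable_compact[OF assms(2) continuous_on_subset[OF assms(1)]] unfolding eq by simp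
  have m: "f \<in> borel_measurable lborel"
    using borel_measurable_continuous_onI[OF assms(1)] by simp
  then have il: "integrable lebesgue f" using i by (simp add: integrable_completion)
  then show "integrable (lebesgue_on D) f"
    using assms(4) by (simp add: integrable_restrict_space integrable_mult_indicator)
  then show "f \<in> borel_measurable (lebesgue_on D)" by auto
qed

lemma integral_lebesgue_on_eq_lborel:
  fixes f :: "real^2 \<Rightarrow> 'b::{banach, second_countable_topology}"
  assumes "continuous_on UNIV f" "\<And>x. x \<notin> D \<Longrightarrow> f x = 0" "D \<in> sets lebesgue"
  shows "integral\<^sup>L (lebesgue_on D) f = integral\<^sup>L lborel f"
proof -
  have "(\<lambda>x. indicator D x *\<^sub>R f x) = f" using assms(2) by (auto simp: indicator_def)
  then have "integral\<^sup>L (lebesgue_on D) f = integral\<^sup>L lebesgue f"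
    using assms(3) by (simp add: integral_restrict_space)
  also have "\<dots> = integral\<^sup>L lborel f"
    using borel_measurable_continuous_onI[OF assms(1)] by (intro integral_completion) simp
  finally show ?thesis .
qed

lemma test_function_H10_rel:
  assumes \<phi>: "\<phi> \<in> test_functions D" and D: "D \<in> sets lebesgue"
  shows "H10_rel D \<phi> (gradient \<phi>)"
proof -
  note c = test_functionsD[OF \<phi>]
  obtain S where S: "compact S" "S \<subseteq> D" "\<And>x. x \<notin> S \<Longrightarrow> \<phi> x = 0" "\<And>x. x \<notin> S \<Longrightarrow> gradient \<phi> x = 0"
    using test_function_support[OF \<phi>] by metis
  have off: "\<phi> x = 0" "gradient \<phi> x = 0" if "x \<notin> D" for x
    using S(2) S(3)[of x] S(4)[of x] that by blast+
  have "L2_on D \<phi>" unfolding L2_on_def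
    using S(3) by (intro conjI continuous_compact_support_integrable[OF _ S(1) _ D] continuous_intros c) auto
  moreover have "L2_on D (gradient \<phi>)" unfolding L2_on_def
    using S(4) by (intro conjI continuous_compact_support_integrable[OF _ S(1) _ D] continuous_intros c) auto
  moreover have "weak_gradient D \<phi> (gradient \<phi>)" unfolding weak_gradient_def
  proof
    fix \<psi> assume \<psi>: "\<psi> \<in> test_functions D"
    note c' = test_functionsD[OF \<psi>]
    have int: "integrable (lebesgue_on D) (\<lambda>x. \<phi> x *\<^sub>R gradient \<psi> x)" "integrable (lebesgue_on D) (\<lambda>x. \<psi> x *\<^sub>R gradient \<phi> x)"
      "integrable lborel (\<lambda>x. \<phi> x *\<^sub>R gradient \<psi> x + \<psi> x *\<^sub>R gradient \<phi> x)"
      using S(3,4) by (intro continuous_compact_support_integrable[OF _ S(1) _ D] continuous_intros c c'; simp)+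
    have "integral\<^sup>L (lebesgue_on D) (\<lambda>x. \<phi> x *\<^sub>R gradient \<psi> x) + integral\<^sup>L (lebesgue_on D) (\<lambda>x. \<psi> x *\<^sub>R gradient \<phi> x)
      = integral\<^sup>L (lebesgue_on D) (\<lambda>x. \<phi> x *\<^sub>R gradient \<psi> x + \<psi> x *\<^sub>R gradient \<phi> x)"
      using int by simp
    also have "\<dots> = integral\<^sup>L lborel (\<lambda>x. \<phi> x *\<^sub>R gradient \<psi> x + \<psi> x *\<^sub>R gradient \<phi> x)"
      using off by (intro integral_lebesgue_on_eq_lborel D continuous_intros c c') auto
    also have "\<dots> = 0"
    proof (rule vec_eq_iff[THEN iffD2], intro allI)
      fix i :: 2
      have "integral\<^sup>L lborel (\<lambda>x. \<phi> x *\<^sub>R gradient \<psi> x + \<psi> x *\<^sub>R gradient \<phi> x) $ i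
        = integral\<^sup>L lborel (\<lambda>x. (\<phi> x *\<^sub>R gradient \<psi> x + \<psi> x *\<^sub>R gradient \<phi> x) $ i)"
        by (rule integral_bounded_linear[OF bounded_linear_vec_nth int(3), symmetric])
      also have "\<dots> = integral\<^sup>L lborel (\<lambda>x. \<phi> x * frechet_derivative \<psi> (at x) (axis i 1) + frechet_derivative \<phi> (at x) (axis i 1) * \<psi> x)"
        by (simp add: gradient_def mult.commute)
      also have "\<dots> = 0"
      proof (rule integral_directional_derivative_eq_0[of "\<lambda>x. \<phi> x * \<psi> x"
            "\<lambda>x v. \<phi> x * frechet_derivative \<psi> (at x) v + frechet_derivative \<phi> (at x) v * \<psi> x", OF _ _ S(1)])
        show "((\<lambda>x. \<phi> x * \<psi> x) has_derivative (\<lambda>v. \<phi> x * frechet_derivative \<psi> (at x) v + frechet_derivative \<phi> (at x) v * \<psi> x)) (at x)" for x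
          by (intro has_derivative_mult c c')
        show "continuous_on UNIV (\<lambda>x. \<phi> x * frechet_derivative \<psi> (at x) (axis i 1) + frechet_derivative \<phi> (at x) (axis i 1) * \<psi> x)"
          by (intro continuous_intros c c')
      qed (use S in auto)
      finally show "integral\<^sup>L lborel (\<lambda>x. \<phi> x *\<^sub>R gradient \<psi> x + \<psi> x *\<^sub>R gradient \<phi> x) $ i = 0 $ i" by simp
    qed
    finally show "integral\<^sup>L (lebesgue_on D) (\<lambda>x. \<phi> x *\<^sub>R gradient \<psi> x) = - integral\<^sup>L (lebesgue_on D) (\<lambda>x. \<psi> x *\<^sub>R gradient \<phi> x)"
      by (simp add: eq_neg_iff_add_eq_0)
  qed
  ultimately have "H1_rel D \<phi> (gradient \<phi>)" by (simp add: H1_rel_def)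
  then show ?thesis unfolding H10_rel_def using \<phi> by (auto intro!: exI[of _ "\<lambda>_. \<phi>"])
qed

lemma L2_on_diff_integrable:
  fixes f g :: "real^2 \<Rightarrow> 'b::euclidean_space"
  assumes "L2_on D f" "L2_on D g"
  shows "integrable (lebesgue_on D) (\<lambda>x. (norm (f x - g x))\<^sup>2)"
proof (rule Bochner_Integration.integrable_bound)
  show "integrable (lebesgue_on D) (\<lambda>x. 2 * (norm (f x))\<^sup>2 + 2 * (norm (g x))\<^sup>2)"
    using assms by (auto simp: L2_on_def)
  show "(\<lambda>x. (norm (f x - g x))\<^sup>2) \<in> borel_measurable (lebesgue_on D)"
    using assms by (auto simp: L2_on_def)
  have "(norm (a - b))\<^sup>2 \<le> 2 * (norm a)\<^sup>2 + 2 * (norm b)\<^sup>2" for a b :: 'b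
  proof -
    have "(norm (a - b))\<^sup>2 \<le> (norm a + norm b)\<^sup>2" by (intro power_mono norm_triangle_ineq4) auto
    also have "\<dots> \<le> 2 * (norm a)\<^sup>2 + 2 * (norm b)\<^sup>2"
      using sum_squares_ge_zero[of "norm a - norm b" 0] by (simp add: power2_eq_square algebra_simps)
    finally show ?thesis .
  qed
  then show "AE x in lebesgue_on D. norm ((norm (f x - g x))\<^sup>2) \<le> norm (2 * (norm (f x))\<^sup>2 + 2 * (norm (g x))\<^sup>2)"
    by (simp add: add_nonneg_nonneg abs_of_nonneg)
qed

text \<open>A pointwise Young inequality bounds the difference of squared norms by a small multiple
  of the limit and a large multiple of the squared distance. It can be integrated directly.\<close>

lemma L2_norm_tendsto:
  fixes f :: "nat \<Rightarrow> real^2 \<Rightarrow> 'b::euclidean_space"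
  assumes f: "\<And>n. L2_on D (f n)" and g: "L2_on D g"
    and lim: "(\<lambda>n. integral\<^sup>L (lebesgue_on D) (\<lambda>x. (norm (f n x - g x))\<^sup>2)) \<longlonglongrightarrow> 0"
  shows "(\<lambda>n. integral\<^sup>L (lebesgue_on D) (\<lambda>x. (norm (f n x))\<^sup>2)) \<longlonglongrightarrow> integral\<^sup>L (lebesgue_on D) (\<lambda>x. (norm (g x))\<^sup>2)"
proof (rule LIMSEQ_I)
  fix e :: real assume e: "e > 0"
  let ?I = "\<lambda>h. integral\<^sup>L (lebesgue_on D) h"
  define G where "G = ?I (\<lambda>x. (norm (g x))\<^sup>2)"
  have G: "G \<ge> 0" by (simp add: G_def)
  \<comment> \<open>The summand 1 keeps the denominator positive when the limit \<open>G\<close> is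
    0.\<close>
  define \<eta> where "\<eta> = e / (2 * (G + 1))"
  have \<eta>: "\<eta> > 0" using e G by (simp add: \<eta>_def)
  define C where "C = 1 + 1 / \<eta>"
  have C: "C > 0" using \<eta> by (simp add: C_def add_pos_pos)
  have pw: "\<bar>(norm a)\<^sup>2 - (norm b)\<^sup>2\<bar> \<le> \<eta> * (norm b)\<^sup>2 + C * (norm (a - b))\<^sup>2" for a b :: 'b
  proof -
    let ?d = "norm (a - b)"
    have d: "\<bar>norm a - norm b\<bar> \<le> ?d" by (rule norm_triangle_ineq3)
    have "(norm a)\<^sup>2 - (norm b)\<^sup>2 = (norm a - norm b)\<^sup>2 + 2 * norm b * (norm a - norm b)"
      by (simp add: power2_eq_square algebra_simps)
    moreover have "(norm a - norm b)\<^sup>2 \<le> ?d\<^sup>2" using d by (metis abs_ge_zero power2_abs power_mono)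
    moreover have "\<bar>2 * norm b * (norm a - norm b)\<bar> \<le> 2 * norm b * ?d"
      using d by (simp add: abs_mult mult_left_mono)
    moreover have "2 * norm b * ?d \<le> \<eta> * (norm b)\<^sup>2 + (1 / \<eta>) * ?d\<^sup>2"
    proof -
      have "0 \<le> (\<eta> * norm b - ?d)\<^sup>2 / \<eta>" using \<eta> by simp
      also have "\<dots> = \<eta> * (norm b)\<^sup>2 + (1 / \<eta>) * ?d\<^sup>2 - 2 * norm b * ?d"
        using \<eta> by (simp add: power2_eq_square field_simps)
      finally show ?thesis by simp
    qed
    moreover have "C * ?d\<^sup>2 = ?d\<^sup>2 + (1 / \<eta>) * ?d\<^sup>2" by (simp add: C_def distrib_right)
    moreover have "0 \<le> (norm a - norm b)\<^sup>2" by simp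
    ultimately show ?thesis by linarith
  qed
  obtain N where N: "\<And>n. n \<ge> N \<Longrightarrow> norm (?I (\<lambda>x. (norm (f n x - g x))\<^sup>2) - 0) < e / (2 * C)"
    using LIMSEQ_D[OF lim, of "e / (2 * C)"] e C by auto
  have "norm (?I (\<lambda>x. (norm (f n x))\<^sup>2) - G) < e" if "n \<ge> N" for n
  proof -
    have i: "integrable (lebesgue_on D) (\<lambda>x. (norm (f n x))\<^sup>2)" "integrable (lebesgue_on D) (\<lambda>x. (norm (g x))\<^sup>2)"
      "integrable (lebesgue_on D) (\<lambda>x. (norm (f n x - g x))\<^sup>2)"
      using f[of n] g L2_on_diff_integrable[OF f[of n] g] by (auto simp: L2_on_def)
    have "norm (?I (\<lambda>x. (norm (f n x))\<^sup>2) - G) = norm (?I (\<lambda>x. (norm (f n x))\<^sup>2 - (norm (g x))\<^sup>2))"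
      using i by (simp add: G_def)
    also have "\<dots> \<le> ?I (\<lambda>x. norm ((norm (f n x))\<^sup>2 - (norm (g x))\<^sup>2))" by (rule integral_norm_bound)
    also have "\<dots> \<le> ?I (\<lambda>x. \<eta> * (norm (g x))\<^sup>2 + C * (norm (f n x - g x))\<^sup>2)"
      using i pw by (intro integral_mono) auto
    also have "\<dots> = \<eta> * G + C * ?I (\<lambda>x. (norm (f n x - g x))\<^sup>2)" using i by (simp add: G_def)
    also have "\<dots> < e / 2 + C * (e / (2 * C))"
    proof (rule add_le_less_mono)
      show "\<eta> * G \<le> e / 2" using e G by (simp add: \<eta>_def field_simps)
      have "?I (\<lambda>x. (norm (f n x - g x))\<^sup>2) < e / (2 * C)" using N[OF that] by simp
      then show "C * ?I (\<lambda>x. (norm (f n x - g x))\<^sup>2) < C * (e / (2 * C))"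
        using C by (intro mult_strict_left_mono)
    qed
    also have "\<dots> = e" using C by simp
    finally show ?thesis .
  qed
  then show "\<exists>N. \<forall>n\<ge>N. norm (?I (\<lambda>x. (norm (f n x))\<^sup>2) - ?I (\<lambda>x. (norm (g x))\<^sup>2)) < e"
    unfolding G_def by blast
qed

text \<open>The integrals run over the whole plane, so the value does not depend on the domain in
  which the test function is considered and can be compared across different
  \<open>\<Omega> - K n\<close>.\<close>

definition test_rayleigh :: "(real^2 \<Rightarrow> real) \<Rightarrow> real" where
  "test_rayleigh \<phi> = integral\<^sup>L lborel (\<lambda>x. (norm (gradient \<phi> x))\<^sup>2) / integral\<^sup>L lborel (\<lambda>x. (\<phi> x)\<^sup>2)"

lemma test_function_integrals:
  assumes \<phi>: "\<phi> \<in> test_functions D" and D: "D \<in> sets lebesgue"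
  shows "integral\<^sup>L (lebesgue_on D) (\<lambda>x. (\<phi> x)\<^sup>2) = integral\<^sup>L lborel (\<lambda>x. (\<phi> x)\<^sup>2)"
    and "integral\<^sup>L (lebesgue_on D) (\<lambda>x. (norm (gradient \<phi> x))\<^sup>2) = integral\<^sup>L lborel (\<lambda>x. (norm (gradient \<phi> x))\<^sup>2)"
proof -
  note c = test_functionsD[OF \<phi>]
  obtain S where S: "compact S" "S \<subseteq> D" "\<And>x. x \<notin> S \<Longrightarrow> \<phi> x = 0" "\<And>x. x \<notin> S \<Longrightarrow> gradient \<phi> x = 0"
    using test_function_support[OF \<phi>] by metis
  have off: "\<phi> x = 0" "gradient \<phi> x = 0" if "x \<notin> D" for x
    using S(2) S(3)[of x] S(4)[of x] that by blast+
  show "integral\<^sup>L (lebesgue_on D) (\<lambda>x. (\<phi> x)\<^sup>2) = integral\<^sup>L lborel (\<lambda>x. (\<phi> x)\<^sup>2)"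
    using off by (intro integral_lebesgue_on_eq_lborel D continuous_intros c) auto
  show "integral\<^sup>L (lebesgue_on D) (\<lambda>x. (norm (gradient \<phi> x))\<^sup>2) = integral\<^sup>L lborel (\<lambda>x. (norm (gradient \<phi> x))\<^sup>2)"
    using off by (intro integral_lebesgue_on_eq_lborel D continuous_intros c) auto
qed

lemma lambda1_le_test_rayleigh:
  assumes \<phi>: "\<phi> \<in> test_functions D" and D: "D \<in> sets lebesgue" and nz: "integral\<^sup>L lborel (\<lambda>x. (\<phi> x)\<^sup>2) \<noteq> 0"
  shows "lambda1 D \<le> ereal (test_rayleigh \<phi>)"
proof -
  have "\<not> (AE x in lebesgue_on D. \<phi> x = 0)"
  proof
    assume "AE x in lebesgue_on D. \<phi> x = 0"
    then have "integral\<^sup>L (lebesgue_on D) (\<lambda>x. (\<phi> x)\<^sup>2) = 0"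
      by (intro integral_eq_zero_AE) auto
    then show False using nz test_function_integrals[OF \<phi> D] by simp
  qed
  then show ?thesis unfolding lambda1_def test_rayleigh_def test_function_integrals[OF \<phi> D, symmetric]
    using test_function_H10_rel[OF \<phi> D] by (intro Inf_lower) blast
qed

text \<open>By density the Rayleigh quotient of a function in \<open>H10_rel\<close> is a limit of
  quotients of test functions, so the eigenvalue is an infimum over test functions. With an empty
  domain this infimum is \<infinity>, which covers continua that exhaust
  \<open>\<Omega>\<close>.\<close>

lemma lambda1_ge_if_le_test_rayleigh:
  assumes D: "D \<in> sets lebesgue"
    and le: "\<And>\<phi>. \<phi> \<in> test_functions D \<Longrightarrow> integral\<^sup>L lborel (\<lambda>x. (\<phi> x)\<^sup>2) \<noteq> 0 \<Longrightarrow> c \<le> ereal (test_rayleigh \<phi>)"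
  shows "c \<le> lambda1 D"
  unfolding lambda1_def
proof (rule Inf_greatest, clarify)
  fix u g assume H: "H10_rel D u g" and nz: "\<not> (AE x in lebesgue_on D. u x = 0)"
  let ?I = "\<lambda>h. integral\<^sup>L (lebesgue_on D) h"
  have L2: "L2_on D u" "L2_on D g" using H by (auto simp: H10_rel_def H1_rel_def)
  obtain \<phi> where \<phi>: "\<And>n. \<phi> n \<in> test_functions D"
    and lim: "(\<lambda>n. ?I (\<lambda>x. (\<phi> n x - u x)\<^sup>2) + ?I (\<lambda>x. (norm (gradient (\<phi> n) x - g x))\<^sup>2)) \<longlonglongrightarrow> 0"
    using H by (auto simp: H10_rel_def)
  have L2\<phi>: "L2_on D (\<phi> n)" "L2_on D (gradient (\<phi> n))" for n
    using test_function_H10_rel[OF \<phi> D, of n] by (auto simp: H10_rel_def H1_rel_def)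
  have "(\<lambda>n. ?I (\<lambda>x. (norm (\<phi> n x - u x))\<^sup>2)) \<longlonglongrightarrow> 0"
    by (rule tendsto_sandwich[OF _ _ tendsto_const lim]) auto
  then have "(\<lambda>n. ?I (\<lambda>x. (norm (\<phi> n x))\<^sup>2)) \<longlonglongrightarrow> ?I (\<lambda>x. (norm (u x))\<^sup>2)"
    by (rule L2_norm_tendsto[OF L2\<phi>(1) L2(1)])
  then have 1: "(\<lambda>n. integral\<^sup>L lborel (\<lambda>x. (\<phi> n x)\<^sup>2)) \<longlonglongrightarrow> ?I (\<lambda>x. (u x)\<^sup>2)"
    by (simp add: test_function_integrals[OF \<phi> D])
  have "(\<lambda>n. ?I (\<lambda>x. (norm (gradient (\<phi> n) x - g x))\<^sup>2)) \<longlonglongrightarrow> 0"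
    by (rule tendsto_sandwich[OF _ _ tendsto_const lim]) auto
  then have "(\<lambda>n. ?I (\<lambda>x. (norm (gradient (\<phi> n) x))\<^sup>2)) \<longlonglongrightarrow> ?I (\<lambda>x. (norm (g x))\<^sup>2)"
    by (rule L2_norm_tendsto[OF L2\<phi>(2) L2(2)])
  then have 2: "(\<lambda>n. integral\<^sup>L lborel (\<lambda>x. (norm (gradient (\<phi> n) x))\<^sup>2)) \<longlonglongrightarrow> ?I (\<lambda>x. (norm (g x))\<^sup>2)"
    by (simp add: test_function_integrals[OF \<phi> D])
  have u: "?I (\<lambda>x. (u x)\<^sup>2) \<noteq> 0"
  proof
    assume "?I (\<lambda>x. (u x)\<^sup>2) = 0"
    moreover have "integrable (lebesgue_on D) (\<lambda>x. (u x)\<^sup>2)" using L2(1) by (simp add: L2_on_def)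
    ultimately have "AE x in lebesgue_on D. (u x)\<^sup>2 = 0"
      using integral_nonneg_eq_0_iff_AE[of "lebesgue_on D" "\<lambda>x. (u x)\<^sup>2"] by simp
    then show False using nz by simp
  qed
  have "(\<lambda>n. ereal (test_rayleigh (\<phi> n))) \<longlonglongrightarrow> ereal (?I (\<lambda>x. (norm (g x))\<^sup>2) / ?I (\<lambda>x. (u x)\<^sup>2))"
    unfolding test_rayleigh_def by (intro tendsto_ereal tendsto_divide 1 2 u)
  moreover have "eventually (\<lambda>n. c \<le> ereal (test_rayleigh (\<phi> n))) sequentially"
    using tendsto_imp_eventually_ne[OF 1 u] by eventually_elim (rule le[OF \<phi>])
  ultimately show "c \<le> ereal (?I (\<lambda>x. (norm (g x))\<^sup>2) / ?I (\<lambda>x. (u x)\<^sup>2))"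
    by (intro tendsto_lowerbound) auto
qed

text \<open>Only the easy half of the \<open>\<gamma>\<close>-continuity of the Dirichlet problem is needed: a test function
  supported away from the limit set is eventually supported away from the approximating sets.\<close>

lemma lambda1_diff_upper_semicontinuous:
  assumes \<Omega>: "open \<Omega>" and K: "\<And>n. closed (K n)" "closed K'"
    and upper: "\<And>U. open U \<Longrightarrow> K' \<subseteq> U \<Longrightarrow> eventually (\<lambda>n. K n \<subseteq> U) sequentially"
    and lim: "(\<lambda>n. lambda1 (\<Omega> - K n)) \<longlonglongrightarrow> c"
  shows "c \<le> lambda1 (\<Omega> - K')"
proof (rule lambda1_ge_if_le_test_rayleigh)
  have meas: "\<Omega> - C \<in> sets lebesgue" if "closed C" for C
    using \<Omega> that open_Diff[of \<Omega> C] by (auto intro: lebesgue_openin)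
  then show "\<Omega> - K' \<in> sets lebesgue" using K by blast
  fix \<phi> assume \<phi>: "\<phi> \<in> test_functions (\<Omega> - K')" and nz: "integral\<^sup>L lborel (\<lambda>x. (\<phi> x)\<^sup>2) \<noteq> 0"
  let ?S = "closure {x. \<phi> x \<noteq> 0}"
  have "open (- ?S)" "K' \<subseteq> - ?S" using \<phi> by (auto simp: test_functions_def)
  then have "eventually (\<lambda>n. K n \<subseteq> - ?S) sequentially" by (rule upper)
  then have "eventually (\<lambda>n. lambda1 (\<Omega> - K n) \<le> ereal (test_rayleigh \<phi>)) sequentially"
  proof eventually_elim
    case (elim n)
    then have "\<phi> \<in> test_functions (\<Omega> - K n)" using \<phi> by (auto simp: test_functions_def)
    then show ?case using lambda1_le_test_rayleigh meas K nz by blast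
  qed
  then show "c \<le> ereal (test_rayleigh \<phi>)"
    using lim by (intro tendsto_upperbound) auto
qed

section \<open>Existence of an optimal continuum\<close>

theorem theorem3p1:
  fixes \<Omega> :: "(real^2) set" and L :: real
  assumes "open \<Omega>" and "connected \<Omega>" and "\<Omega> \<noteq> {}" and "bounded \<Omega>"
    and "0 < L" and "ennreal L < outer_minkowski_content (closure \<Omega>)"
  shows "\<exists>K_opt. K_opt \<subseteq> closure \<Omega> \<and> continuum K_opt \<and> outer_minkowski_content K_opt \<le> ennreal L \<and>
           (\<forall>K. K \<subseteq> closure \<Omega> \<and> continuum K \<and> outer_minkowski_content K \<le> ennreal L
                \<longrightarrow> lambda1 (\<Omega> - K) \<le> lambda1 (\<Omega> - K_opt))"
proof -
  define adm where "adm K \<longleftrightarrow> K \<subseteq> closure \<Omega> \<and> continuum K \<and> outer_minkowski_content K \<le> ennreal L" for K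
  define A where "A = {lambda1 (\<Omega> - K) | K. adm K}"
  have L: "0 \<le> L" using assms(5) by simp
  obtain x where "x \<in> \<Omega>" using assms(3) by blast
  then have "adm {x}"
    using closure_subset[of \<Omega>] continuum_singleton outer_minkowski_content_singleton_le[OF L] by (auto simp: adm_def)
  then have "A \<noteq> {}" by (auto simp: A_def)
  \<comment> \<open>The supremum is taken in \<open>ereal\<close> and may a priori be infinite.
    Monotonicity makes the whole maximising sequence converge to it, hence every subsequence as
    well.\<close>
  then obtain f :: "nat \<Rightarrow> ereal" where f: "incseq f" "range f \<subseteq> A" "Sup A = (SUP n. f n)"
    using Sup_countable_SUP by blast
  have "\<exists>K. adm K \<and> f n = lambda1 (\<Omega> - K)" for n using f(2) by (auto simp: A_def)
  then obtain K where K: "\<And>n. adm (K n)" "\<And>n. f n = lambda1 (\<Omega> - K n)" by metis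
  have K': "continuum (K n)" "K n \<subseteq> closure \<Omega>" "outer_minkowski_content (K n) \<le> ennreal L" for n
    using K(1)[of n] by (auto simp: adm_def)
  have "compact (closure \<Omega>)" using assms(4) by (simp add: compact_closure)
  then obtain r K_opt where r: "strict_mono (r :: nat \<Rightarrow> nat)" and opt: "continuum K_opt" "K_opt \<subseteq> closure \<Omega>"
    and upper: "\<And>U. open U \<Longrightarrow> K_opt \<subseteq> U \<Longrightarrow> eventually (\<lambda>n. K (r n) \<subseteq> U) sequentially"
    and lower: "\<And>e. 0 < e \<Longrightarrow> eventually (\<lambda>n. K_opt \<subseteq> closed_nbhd e (K (r n))) sequentially"
    by (rule continua_convergent_subsequence[of "closure \<Omega>" K, OF _ K'(1,2)]) simp_all
  have content: "outer_minkowski_content K_opt \<le> ennreal L"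
    by (rule outer_minkowski_content_lower_semicontinuous[of "\<lambda>n. K (r n)", OF K'(1) opt(1) L K'(3) upper lower])
  have "f \<longlonglongrightarrow> Sup A" using LIMSEQ_SUP[OF f(1)] f(3) by simp
  then have "(\<lambda>n. lambda1 (\<Omega> - K (r n))) \<longlonglongrightarrow> Sup A"
    using LIMSEQ_subseq_LIMSEQ[OF _ r, of f] K(2) by (simp add: o_def)
  then have "Sup A \<le> lambda1 (\<Omega> - K_opt)"
    using K'(1) opt(1) compact_imp_closed
    by (intro lambda1_diff_upper_semicontinuous[of _ "\<lambda>n. K (r n)", OF assms(1) _ _ upper]) (auto simp: continuum_def)
  moreover have "lambda1 (\<Omega> - C) \<le> Sup A" if "adm C" for C
    using that by (intro Sup_upper) (auto simp: A_def)
  ultimately have "\<forall>C. adm C \<longrightarrow> lambda1 (\<Omega> - C) \<le> lambda1 (\<Omega> - K_opt)"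
    by (meson order_trans)
  then show ?thesis using opt content unfolding adm_def by blast
qed

end
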